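(* Let $N\ge 3$, $\Omega=\{x\in\mathbb{R}^N : 1<|x|<3\}$, $\Psi_\alpha(x)=\big||x|-2\big|^\alpha$ for $\alpha>0$, and for $p>2$, $u\in H^1_0(\Omega)\setminus\{0\}$, $$R_{\alpha,p}(u)=\frac{\int_\Omega|\nabla u|^2\,dx}{\left(\int_\Omega \Psi_\alpha |u|^p\,dx\right)^{2/p}}.$$ Let $p\in(2,2^* )$, $2^*=2N/(N-2)$. Then for all sufficiently large $\alpha$, every ground state $u_{\alpha,p}$ (i.e. every minimizer of $R_{\alpha,p}$ over $H^1_0(\Omega)\setminus\{0\}$) is a non-radial function.
   Context: Minimizers of $R_{\alpha,p}$, suitably rescaled, are solutions of $-\Delta u=\Psi_\alpha u^{p-1}$, $u>0$ in $\Omega$, $u=0$ on $\partial\Omega$; these are called ground states. *)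

theory Defs
  imports "HOL-Analysis.Analysis"
begin

definition annulus :: "(real^'n) set" where
  "annulus = {x. 1 < norm x \<and> norm x < 3}"

definition Psi :: "real \<Rightarrow> real^'n \<Rightarrow> real" where
  "Psi \<alpha> x = \<bar>norm x - 2\<bar> powr \<alpha>"

definition grad :: "(real^'n \<Rightarrow> real) \<Rightarrow> real^'n \<Rightarrow> real^'n" where
  "grad f x = (\<chi> i. frechet_derivative f (at x) (axis i 1))"

fun Ck :: "nat \<Rightarrow> (real^'n \<Rightarrow> real) \<Rightarrow> bool" where
  "Ck 0 f = continuous_on UNIV f"
| "Ck (Suc k) f = ((\<forall>x. f differentiable (at x)) \<and>
      (\<forall>i. Ck k (\<lambda>x. frechet_derivative f (at x) (axis i 1))))"

definition smooth :: "(real^'n \<Rightarrow> real) \<Rightarrow> bool" where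
  "smooth f = (\<forall>k. Ck k f)"

definition test_fun :: "(real^'n) set \<Rightarrow> (real^'n \<Rightarrow> real) \<Rightarrow> bool" where
  "test_fun U f = (smooth f \<and> compact (closure {x. f x \<noteq> 0})
                   \<and> closure {x. f x \<noteq> 0} \<subseteq> U)"

text \<open>H^1_0(U) as the completion of C_c^\<infinity>(U) in the H^1 norm:
  u (extended by zero to R^N) with weak gradient G is the L^2-limit of test
  functions whose gradients converge in L^2 to G.\<close>
definition H10_grad :: "(real^'n) set \<Rightarrow> (real^'n \<Rightarrow> real) \<Rightarrow> (real^'n \<Rightarrow> real^'n) \<Rightarrow> bool" where
  "H10_grad U u G = (u \<in> borel_measurable lborel \<and> G \<in> borel_measurable lborel \<and>
     integrable lborel (\<lambda>x. (u x)\<^sup>2) \<and> integrable lborel (\<lambda>x. (norm (G x))\<^sup>2) \<and>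
     (\<exists>\<phi> :: nat \<Rightarrow> real^'n \<Rightarrow> real. (\<forall>k. test_fun U (\<phi> k)) \<and>
        (\<lambda>k. \<integral>x. (\<phi> k x - u x)\<^sup>2 \<partial>lborel) \<longlonglongrightarrow> 0 \<and>
        (\<lambda>k. \<integral>x. (norm (grad (\<phi> k) x - G x))\<^sup>2 \<partial>lborel) \<longlonglongrightarrow> 0))"

definition nonzero_fun :: "(real^'n \<Rightarrow> real) \<Rightarrow> bool" where
  "nonzero_fun u = (\<not> (AE x in lborel. u x = 0))"

text \<open>Rayleigh quotient R_{\<alpha>,p}(u), with G the weak gradient of u.\<close>
definition Rayleigh :: "real \<Rightarrow> real \<Rightarrow> (real^'n \<Rightarrow> real) \<Rightarrow> (real^'n \<Rightarrow> real^'n) \<Rightarrow> real" where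
  "Rayleigh \<alpha> p u G =
     (LINT x:annulus|lborel. (norm (G x))\<^sup>2) /
     (LINT x:annulus|lborel. Psi \<alpha> x * \<bar>u x\<bar> powr p) powr (2 / p)"

definition ground_state :: "real \<Rightarrow> real \<Rightarrow> (real^'n \<Rightarrow> real) \<Rightarrow> bool" where
  "ground_state \<alpha> p u = (\<exists>G. H10_grad annulus u G \<and> nonzero_fun u \<and>
     (\<forall>(v :: real^'n \<Rightarrow> real) H. H10_grad annulus v H \<and> nonzero_fun v \<longrightarrow> Rayleigh \<alpha> p u G \<le> Rayleigh \<alpha> p v H))"

definition radial :: "(real^'n \<Rightarrow> real) \<Rightarrow> bool" where
  "radial u = (\<exists>f :: real \<Rightarrow> real. AE x in lborel. u x = f (norm x))"

end

theory Submission
  imports Defs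
begin

text \<open>
  A radial \<open>u\<close> is controlled on almost every ray by the one-dimensional estimate
  \<open>u(r)\<^sup>2 \<le> d(r) \<integral> \<bar>u'\<bar>\<^sup>2\<close>, where \<open>d(r) = 1 - \<bar>r - 2\<bar>\<close> is the distance to the boundary. Hence the
  denominator of the Rayleigh quotient is at most a constant times
  \<open>D\<^bsup>p/2\<^esup> \<integral> \<bar>r - 2\<bar>\<^bsup>\<alpha>\<^esup> d(r)\<^bsup>p/2\<^esup> dr\<close>, with \<open>D\<close> the Dirichlet energy, and this weight integral is
  \<open>O(\<alpha>\<^bsup>-(p/2+1)\<^esup>)\<close>. So the quotient of a radial function is at least \<open>c \<alpha>\<^bsup>1+2/p\<^esup>\<close>.
  A bump of radius \<open>1/\<alpha>\<close> centred at distance \<open>2/\<alpha>\<close> from the outer sphere, where the weight stays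
  bounded below, has quotient at most \<open>C \<alpha>\<^bsup>2-N+2N/p\<^esup>\<close>. The exponents differ by \<open>(N-1)(1-2/p) > 0\<close>,
  so for large \<open>\<alpha>\<close> no radial function is a minimizer.
\<close>

section \<open>Smooth bump functions\<close>

text \<open>At distance d from the boundary the weight is \<open>(1 - d) powr \<alpha>\<close>,
  roughly exp(-\<alpha> d), so only a layer of width of order 1/\<alpha> matters. A radial function
  has to spread over the whole layer, whereas a bump also concentrates in the N - 1 tangential
  directions; this is the source of the factor N - 1 in the gap between the exponents. An element of
  H^1_0 has no values on a prescribed ray. Ray estimates are therefore proved for test functions and
  reach \<open>u\<close> through an a.e. convergent subsequence and Fatou's lemma. Polar coordinates
  are replaced by the map (t, z) to t z with z in a set of positive measure: scaling for fixed t, a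
  one-dimensional substitution for fixed z, and Tonelli between the two. The constants this costs
  are harmless, since only powers of \<alpha> are compared. By convention the integral of a
  non-integrable function is 0 and so is a quotient by 0. A degenerate denominator would make the
  Rayleigh quotient 0, so the lower bound has to include integrability and positivity of the
  weighted integral.\<close>

lemma Ck_Suc_imp: "Ck (Suc k) f \<Longrightarrow> Ck k f"
proof (induction k arbitrary: f)
  case 0
  then show ?case
    by (auto intro!: continuous_at_imp_continuous_on differentiable_imp_continuous_within)
next
  case (Suc k)
  then show ?case by (metis Ck.simps(2))
qed

lemma Ck_const: "Ck k (\<lambda>x. c)"
  by (induction k arbitrary: c) auto

lemma Ck_add: "Ck k f \<Longrightarrow> Ck k g \<Longrightarrow> Ck k (\<lambda>x. f x + g x)"
proof (induction k arbitrary: f g)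
  case 0
  then show ?case by (auto intro: continuous_intros)
next
  case (Suc k)
  have "frechet_derivative (\<lambda>x. f x + g x) (at x) =
      (\<lambda>h. frechet_derivative f (at x) h + frechet_derivative g (at x) h)" for x
    using Suc.prems by (intro frechet_derivative_at[symmetric] has_derivative_add)
      (auto simp: frechet_derivative_works[symmetric])
  with Suc show ?case by auto
qed

lemma Ck_mult: "Ck k f \<Longrightarrow> Ck k g \<Longrightarrow> Ck k (\<lambda>x. f x * g x)"
proof (induction k arbitrary: f g)
  case 0
  then show ?case by (auto intro: continuous_intros)
next
  case (Suc k)
  have "frechet_derivative (\<lambda>x. f x * g x) (at x) =
      (\<lambda>h. f x * frechet_derivative g (at x) h + frechet_derivative f (at x) h * g x)" for x
    using Suc.prems by (intro frechet_derivative_at[symmetric] has_derivative_mult)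
      (auto simp: frechet_derivative_works[symmetric])
  moreover have "Ck k f" "Ck k g"
    using Suc.prems Ck_Suc_imp by auto
  ultimately show ?case
    using Suc.prems by (auto intro!: Ck_add Suc.IH)
qed

lemma has_derivative_compose_real:
  fixes q :: "'a::real_normed_vector \<Rightarrow> real"
  assumes "(h has_real_derivative h') (at (q x))" "(q has_derivative q') (at x)"
  shows "((\<lambda>x. h (q x)) has_derivative (\<lambda>v. h' * q' v)) (at x)"
  using has_derivative_compose[OF assms(2) assms(1)[unfolded has_field_derivative_def]] by simp

text \<open>The chain rule leads from \<open>h j\<close> to \<open>h (Suc j)\<close> times a partial
  derivative of \<open>q\<close>. Carrying the whole sequence of derivatives, with \<open>j\<close>
  arbitrary, is what closes the induction.\<close>

lemma Ck_compose:
  fixes h :: "nat \<Rightarrow> real \<Rightarrow> real"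
  assumes h: "\<And>j t. (h j has_real_derivative h (Suc j) t) (at t)"
  shows "Ck k q \<Longrightarrow> Ck k (\<lambda>x. h j (q x))"
proof (induction k arbitrary: j)
  case 0
  have "continuous_on UNIV (h j)"
    using h by (meson DERIV_continuous continuous_at_imp_continuous_on)
  with 0 show ?case
    by (auto intro: continuous_on_compose2[of UNIV "h j"])
next
  case (Suc k)
  have d: "((\<lambda>x. h j (q x)) has_derivative
      (\<lambda>v. h (Suc j) (q x) * frechet_derivative q (at x) v)) (at x)" for x
    by (rule has_derivative_compose_real[OF h])
      (use Suc.prems in \<open>auto simp: frechet_derivative_works[symmetric]\<close>)
  have "frechet_derivative (\<lambda>x. h j (q x)) (at x) =
      (\<lambda>v. h (Suc j) (q x) * frechet_derivative q (at x) v)" for x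
    using frechet_derivative_at[OF d] by simp
  moreover have "Ck k q"
    using Suc.prems Ck_Suc_imp by auto
  ultimately show ?case
    using Suc.prems d by (auto intro!: Ck_mult Suc.IH simp: differentiable_def)
qed

lemma Ck_affine: "Ck k (\<lambda>x. a \<bullet> x + b)"
proof (cases k)
  case (Suc l)
  have d: "((\<lambda>x. a \<bullet> x + b) has_derivative (\<lambda>v. a \<bullet> v)) (at x)" for x
    by (auto intro!: derivative_eq_intros)
  show ?thesis
    using d frechet_derivative_at[OF d, symmetric]
    by (auto simp: Suc differentiable_def intro!: Ck_const)
qed (simp, intro continuous_intros)

lemma has_derivative_quadratic:
  fixes c :: "'a::real_inner"
  shows "((\<lambda>x. 1 - ((x - c) \<bullet> (x - c)) / s) has_derivative (\<lambda>v. - 2 * ((x - c) \<bullet> v) / s)) (at x)"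
proof -
  have "((\<lambda>x. 1 - ((x - c) \<bullet> (x - c)) / s) has_derivative (\<lambda>v. 0 - ((x - c) \<bullet> (v - 0) + (v - 0) \<bullet> (x - c)) / s)) (at x)"
    unfolding divide_inverse by (intro derivative_intros)
  moreover have "(\<lambda>v. 0 - ((x - c) \<bullet> (v - 0) + (v - 0) \<bullet> (x - c)) / s) = (\<lambda>v. - 2 * ((x - c) \<bullet> v) / s)"
    by (simp add: inner_commute)
  ultimately show ?thesis by simp
qed

lemma Ck_quadratic: "Ck k (\<lambda>x::real^'n. 1 - ((x - c) \<bullet> (x - c)) / s)"
proof (cases k)
  case (Suc l)
  have *: "- 2 * ((x - c) \<bullet> axis i 1) / s
      = ((- 2 / s) *\<^sub>R axis i 1) \<bullet> x + (2 * (c \<bullet> axis i 1) / s)" for x :: "real^'n" and i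
    by (simp add: inner_diff_right inner_commute[of _ "axis _ _"] diff_divide_distrib
        right_diff_distrib)
  let ?q = "\<lambda>x::real^'n. 1 - ((x - c) \<bullet> (x - c)) / s"
  have "frechet_derivative ?q (at x) = (\<lambda>v. - 2 * ((x - c) \<bullet> v) / s)" for x
    by (rule frechet_derivative_at[OF has_derivative_quadratic, symmetric])
  then have "Ck l (\<lambda>x. frechet_derivative ?q (at x) (axis i 1))" for i
    by (simp only: *) (rule Ck_affine)
  moreover have "?q differentiable (at x)" for x
    unfolding differentiable_def by (rule exI, rule has_derivative_quadratic)
  ultimately show ?thesis
    unfolding Suc Ck.simps by blast
next
  case 0
  then show ?thesis
    unfolding divide_inverse by (simp only: Ck.simps, intro continuous_intros)
qed

text \<open>The classical flat function exp(-1/t) with a polynomial factor in 1/t. The factor makes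
  the class closed under differentiation, so one derivative computation covers all orders.\<close>

definition exp_profile :: "real poly \<Rightarrow> real \<Rightarrow> real" where
  "exp_profile P t = (if t > 0 then poly P (1 / t) * exp (- (1 / t)) else 0)"

lemma tendsto_poly_div_exp_0:
  fixes P :: "real poly"
  shows "((\<lambda>x. poly P x * exp (- x)) \<longlongrightarrow> 0) at_top"
proof -
  have "((\<lambda>x. \<Sum>i\<le>degree P. coeff P i * (x ^ i / exp x)) \<longlongrightarrow> (\<Sum>i\<le>degree P. coeff P i * 0)) at_top"
    by (intro tendsto_intros tendsto_power_div_exp_0)
  then show ?thesis
    by (simp add: poly_altdef exp_minus field_simps sum_divide_distrib)
qed

lemma exp_profile_tendsto_0: "(exp_profile P \<longlongrightarrow> 0) (at 0)"
proof -
  have "((\<lambda>t. poly P (1 / t) * exp (- (1 / t))) \<longlongrightarrow> 0) (at_right (0::real))"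
    by (rule filterlim_compose[OF tendsto_poly_div_exp_0])
      (auto simp: filterlim_inverse_at_top_right divide_inverse)
  moreover have "eventually (\<lambda>t. poly P (1 / t) * exp (- (1 / t)) = exp_profile P t) (at_right 0)"
    by (auto simp: eventually_at_filter exp_profile_def)
  ultimately have "(exp_profile P \<longlongrightarrow> 0) (at_right 0)"
    by (rule Lim_transform_eventually)
  moreover have "eventually (\<lambda>t. 0 = exp_profile P t) (at_left 0)"
    by (auto simp: eventually_at_filter exp_profile_def)
  then have "(exp_profile P \<longlongrightarrow> 0) (at_left 0)"
    by (rule Lim_transform_eventually[OF tendsto_const])
  ultimately show ?thesis
    by (simp add: filterlim_split_at)
qed

text \<open>Differentiating P(1/t) exp(-1/t) yields (1/t)^2 (P - P')(1/t) exp(-1/t), and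
  \<open>[:0, 0, 1:]\<close> is the square of the variable.\<close>

lemma exp_profile_DERIV:
  "(exp_profile P has_real_derivative exp_profile ([:0, 0, 1:] * (P - pderiv P)) t) (at t)"
proof -
  consider "t > 0" | "t < 0" | "t = 0" by linarith
  then show ?thesis
  proof cases
    case 1
    have "((\<lambda>t. poly P (1 / t) * exp (- (1 / t))) has_real_derivative
        exp_profile ([:0, 0, 1:] * (P - pderiv P)) t) (at t)"
      using 1 unfolding exp_profile_def
      by (auto intro!: derivative_eq_intros DERIV_chain'[OF _ poly_DERIV]
          simp: field_simps power2_eq_square)
    then show ?thesis
      by (rule has_field_derivative_transform_within_open[of _ _ _ "{0<..}"])
        (use 1 in \<open>auto simp: exp_profile_def\<close>)
  next
    case 2
    have "((\<lambda>t. 0) has_real_derivative exp_profile ([:0, 0, 1:] * (P - pderiv P)) t) (at t)"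
      using 2 by (auto simp: exp_profile_def)
    then show ?thesis
      by (rule has_field_derivative_transform_within_open[of _ _ _ "{..<0}"])
        (use 2 in \<open>auto simp: exp_profile_def\<close>)
  next
    case 3
    \<comment> \<open>The difference quotient at 0 is again a profile, since dividing by h
      multiplies the polynomial by its variable. Flatness of that profile gives the derivative
      0.\<close>
    have "(\<lambda>h. (exp_profile P (0 + h) - exp_profile P 0) / h) = exp_profile ([:0, 1:] * P)"
      by (auto simp: exp_profile_def fun_eq_iff)
    then show ?thesis
      using exp_profile_tendsto_0[of "[:0, 1:] * P"] unfolding 3 DERIV_def
      by (simp add: exp_profile_def)
  qed
qed

text \<open>The squared distance keeps the inner function polynomial, so the centre needs no
  separate treatment.\<close>

definition bump :: "real^'n \<Rightarrow> real \<Rightarrow> real^'n \<Rightarrow> real" where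
  "bump c s x = exp_profile 1 (1 - ((x - c) \<bullet> (x - c)) / s\<^sup>2)"

lemma smooth_bump: "smooth (bump c s)"
proof -
  define h where "h j = exp_profile (((\<lambda>P. [:0, 0, 1:] * (P - pderiv P)) ^^ j) 1)" for j
  have h: "\<And>j t. (h j has_real_derivative h (Suc j) t) (at t)"
    unfolding h_def funpow.simps comp_def by (rule exp_profile_DERIV)
  have "Ck k (\<lambda>x. h 0 (1 - ((x - c) \<bullet> (x - c)) / s\<^sup>2))" for k
    using Ck_compose[where h=h and j=0, OF h Ck_quadratic] by blast
  then show ?thesis
    unfolding smooth_def by (simp add: h_def bump_def[abs_def])
qed

section \<open>Gradients and integrability of test functions\<close>

lemma has_derivative_grad:
  fixes f :: "real^'n \<Rightarrow> real"
  assumes "f differentiable (at x)"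
  shows "(f has_derivative (\<lambda>v. grad f x \<bullet> v)) (at x)"
proof -
  have f: "(f has_derivative frechet_derivative f (at x)) (at x)"
    using assms by (simp add: frechet_derivative_works)
  then interpret linear "frechet_derivative f (at x)"
    by (rule has_derivative_linear)
  have "frechet_derivative f (at x) v = grad f x \<bullet> v" for v
  proof -
    have "frechet_derivative f (at x) v = frechet_derivative f (at x) (\<Sum>i\<in>UNIV. (v $ i) *\<^sub>R axis i 1)"
      using basis_expansion[of v] by (simp add: scalar_mult_eq_scaleR)
    also have "\<dots> = grad f x \<bullet> v"
      by (simp add: sum scale grad_def inner_vec_def mult.commute)
    finally show ?thesis .
  qed
  with f show ?thesis by (metis (no_types, lifting) ext)
qed

lemma grad_eqI:
  fixes f :: "real^'n \<Rightarrow> real"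
  assumes "(f has_derivative (\<lambda>v. w \<bullet> v)) (at x)"
  shows "grad f x = w"
  using frechet_derivative_at[OF assms, symmetric] by (simp add: grad_def vec_eq_iff inner_axis)

lemma smooth_differentiable: "smooth f \<Longrightarrow> f differentiable (at x)"
  unfolding smooth_def by (metis Ck.simps(2))

lemma smooth_continuous: "smooth f \<Longrightarrow> continuous_on UNIV f"
  unfolding smooth_def by (metis Ck.simps(1))

lemma smooth_continuous_grad:
  assumes "smooth f" shows "continuous_on UNIV (grad f)"
proof -
  have "Ck 1 f" using assms by (simp add: smooth_def)
  then show ?thesis
    unfolding grad_def by (auto intro!: continuous_intros)
qed

lemma grad_zero_outside:
  assumes "x \<notin> closure {x. f x \<noteq> 0}"
  shows "grad f x = 0"
proof (rule grad_eqI)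
  have "((\<lambda>_. 0) has_derivative (\<lambda>v. 0 \<bullet> v)) (at x)" by simp
  then show "(f has_derivative (\<lambda>v. 0 \<bullet> v)) (at x)"
    by (rule has_derivative_transform_within_open[of _ _ _ _ "- closure {x. f x \<noteq> 0}"])
      (use assms closure_subset[of "{x. f x \<noteq> 0}"] in \<open>auto simp: closed_open[symmetric]\<close>)
qed

lemma integrable_compact_support:
  fixes g :: "'a::euclidean_space \<Rightarrow> real"
  assumes "continuous_on UNIV g" "compact K" "\<And>x. x \<notin> K \<Longrightarrow> g x = 0"
  shows "integrable lborel g"
proof -
  have "set_integrable lborel K g"
    unfolding set_integrable_def
    by (rule borel_integrable_compact[OF assms(2) continuous_on_subset[OF assms(1) subset_UNIV]])
  moreover have "(\<lambda>x. indicator K x *\<^sub>R g x) = g"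
    using assms(3) by (auto simp: indicator_def fun_eq_iff)
  ultimately show ?thesis by (simp add: set_integrable_def)
qed

lemma test_fun_integrable:
  assumes "test_fun U f"
  shows "integrable lborel (\<lambda>x. (f x)\<^sup>2)" "integrable lborel (\<lambda>x. (norm (grad f x))\<^sup>2)"
proof -
  have s: "smooth f" and K: "compact (closure {x. f x \<noteq> 0})"
    using assms by (auto simp: test_fun_def)
  show "integrable lborel (\<lambda>x. (f x)\<^sup>2)"
    using closure_subset[of "{x. f x \<noteq> 0}"]
    by (intro integrable_compact_support[OF _ K])
      (auto intro!: continuous_intros smooth_continuous[OF s])
  show "integrable lborel (\<lambda>x. (norm (grad f x))\<^sup>2)"
    by (intro integrable_compact_support[OF _ K])
      (auto intro!: continuous_intros smooth_continuous_grad[OF s] simp: grad_zero_outside)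
qed

lemma test_fun_measurable [measurable]:
  assumes "test_fun U f"
  shows "f \<in> borel_measurable borel" "grad f \<in> borel_measurable borel"
  using assms smooth_continuous smooth_continuous_grad
  by (auto simp: test_fun_def intro!: borel_measurable_continuous_onI)

lemma test_fun_H10_grad:
  assumes "test_fun U f"
  shows "H10_grad U f (grad f)"
  unfolding H10_grad_def using assms test_fun_integrable[OF assms] test_fun_measurable[OF assms]
  by (auto intro!: exI[of _ "\<lambda>_. f"])

section \<open>Scaling and integration along rays\<close>

lemma nn_integral_scaleR:
  fixes f :: "'a::euclidean_space \<Rightarrow> ennreal"
  assumes [measurable]: "f \<in> borel_measurable borel" and c: "c \<noteq> 0"
  shows "(\<integral>\<^sup>+x. f x \<partial>lborel) = ennreal (\<bar>c\<bar> ^ DIM('a)) * (\<integral>\<^sup>+x. f (c *\<^sub>R x) \<partial>lborel)"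
  by (subst lborel_affine[OF c, of 0])
     (simp add: nn_integral_density nn_integral_distr nn_integral_cmult ennreal_power)

lemma AE_scaleR:
  fixes P :: "'a::euclidean_space \<Rightarrow> bool"
  assumes c: "c \<noteq> 0" and P: "AE x in lborel. P x"
  shows "AE x in lborel. P (c *\<^sub>R x)"
proof -
  obtain M where M: "{x. \<not> P x} \<subseteq> M" "M \<in> null_sets lborel"
    using P by (auto simp: eventually_ae_filter)
  have [measurable]: "M \<in> sets borel"
    using M(2) by auto
  have "AE x in lborel. x \<notin> M"
    using M(2) by (rule AE_not_in)
  then have "AE x in lborel. c *\<^sub>R x \<notin> M"
    by (subst (asm) lborel_affine[OF c, of 0]) (simp add: AE_density AE_distr_iff c)
  with M(1) show ?thesis
    by (auto elim!: eventually_mono)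
qed

text \<open>For each fixed nonzero t the property survives scaling by t; Tonelli then exchanges the
  order of "almost every". Passing to a Borel null set that contains the exceptional set makes the
  exchange legitimate for an arbitrary \<open>P\<close>.\<close>

lemma AE_rays:
  fixes P :: "'a::euclidean_space \<Rightarrow> bool"
  assumes P: "AE x in lborel. P x"
  shows "AE z in lborel. AE t in lborel. P (t *\<^sub>R z)"
proof -
  obtain M where M: "{x. \<not> P x} \<subseteq> M" "M \<in> null_sets lborel"
    using P by (auto simp: eventually_ae_filter)
  have [measurable]: "M \<in> sets borel"
    using M(2) by auto
  have ae: "AE x in lborel. x \<notin> M"
    using M(2) by (rule AE_not_in)
  have "AE z in lborel. t *\<^sub>R z \<notin> M" if "t \<noteq> 0" for t
    by (rule AE_scaleR[OF that ae])
  moreover have "AE t in lborel. t \<noteq> (0::real)"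
    by (rule AE_lborel_singleton)
  ultimately have "AE t in lborel. AE z in lborel. t *\<^sub>R z \<notin> M"
    by (auto elim: eventually_mono)
  then have "AE z in lborel. AE t in lborel. t *\<^sub>R z \<notin> M"
    by (subst lborel_pair.AE_commute) measurable
  with M(1) show ?thesis
    by (auto elim!: eventually_mono)
qed

section \<open>Dirichlet energy along rays\<close>

lemma annulus_measurable [measurable]: "(annulus :: (real^'n) set) \<in> sets borel"
  unfolding annulus_def by measurable

text \<open>Base points of the rays, a thick substitute for the unit sphere. If z lies here and t z
  in the annulus, then 1/2 < |t| < 3.\<close>

definition shell :: "(real^'n) set" where
  "shell = {z. 1 < norm z \<and> norm z < 2}"

lemma shell_measurable [measurable]: "(shell :: (real^'n) set) \<in> sets borel"
  unfolding shell_def by measurable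

lemma emeasure_shell: "emeasure lborel (shell :: (real^'n) set) = ennreal (measure lborel (shell :: (real^'n) set))"
  and measure_shell_pos: "measure lborel (shell :: (real^'n) set) > 0"
proof -
  have "bounded (shell :: (real^'n) set)"
    by (rule bounded_subset[OF bounded_ball[of 0 2]]) (auto simp: shell_def)
  then have fin: "emeasure lborel (shell :: (real^'n) set) < \<infinity>"
    by (rule emeasure_bounded_finite)
  then show *: "emeasure lborel (shell :: (real^'n) set) = ennreal (measure lborel (shell :: (real^'n) set))"
    by (intro emeasure_eq_ennreal_measure) auto
  obtain a :: "real^'n" where "norm a = 3/2"
    using vector_choose_size[of "3/2"] by auto
  have "ball a (1/2) \<subseteq> shell"
  proof
    fix x assume "x \<in> ball a (1/2)"
    then have "norm (a - x) < 1/2" by (simp add: dist_norm)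
    then show "x \<in> shell"
      using \<open>norm a = 3/2\<close> norm_triangle_ineq3[of a x] by (auto simp: shell_def)
  qed
  then have "emeasure lborel (ball a (1/2)) \<le> emeasure lborel (shell :: (real^'n) set)"
    by (rule emeasure_mono) measurable
  moreover have "emeasure lborel (ball a (1/2)) > 0"
    by (subst emeasure_ball) auto
  ultimately show "measure lborel (shell :: (real^'n) set) > 0"
    unfolding * using order_less_le_trans ennreal_less_zero_iff by blast
qed

text \<open>Values in \<open>ennreal\<close> allow an infinite energy on exceptional rays and make
  Fatou's lemma directly applicable. The parameter t is not arc length; the factor
  \<open>norm z\<close> is accounted for where the energy is used.\<close>

definition ray_energy :: "(real^'n \<Rightarrow> real^'n) \<Rightarrow> real^'n \<Rightarrow> ennreal" where
  "ray_energy H z = (\<integral>\<^sup>+t. indicator annulus (t *\<^sub>R z) * ennreal ((norm (H (t *\<^sub>R z)))\<^sup>2) \<partial>lborel)"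

lemma ray_energy_measurable [measurable]:
  assumes [measurable]: "H \<in> borel_measurable borel"
  shows "ray_energy H \<in> borel_measurable borel"
  unfolding ray_energy_def[abs_def] by measurable

text \<open>After Tonelli, scaling turns the inner integral into at most |t|^(-N) times the energy
  on the annulus. Only 1/2 < |t| < 3 contributes, which gives the factor 2^N and an interval of
  length 6.\<close>

lemma nn_integral_ray_energy_le:
  fixes H :: "real^'n \<Rightarrow> real^'n"
  assumes [measurable]: "H \<in> borel_measurable borel"
  shows "(\<integral>\<^sup>+z. indicator shell z * ray_energy H z \<partial>lborel)
    \<le> ennreal (6 * 2 ^ CARD('n)) * (\<integral>\<^sup>+x. indicator annulus x * ennreal ((norm (H x))\<^sup>2) \<partial>lborel)"
proof -
  define g where "g x = indicator annulus x * ennreal ((norm (H x))\<^sup>2)" for x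
  have [measurable]: "g \<in> borel_measurable borel"
    unfolding g_def by measurable
  have "(\<integral>\<^sup>+z. indicator shell z * ray_energy H z \<partial>lborel)
      = (\<integral>\<^sup>+z. \<integral>\<^sup>+t. indicator shell z * g (t *\<^sub>R z) \<partial>lborel \<partial>lborel)"
    unfolding ray_energy_def g_def by (intro nn_integral_cong nn_integral_cmult[symmetric]) measurable
  also have "\<dots> = (\<integral>\<^sup>+t. \<integral>\<^sup>+z. indicator shell z * g (t *\<^sub>R z) \<partial>lborel \<partial>lborel)"
    by (rule lborel_pair.Fubini') measurable
  also have "\<dots> \<le> (\<integral>\<^sup>+t. ennreal (2 ^ CARD('n)) * integral\<^sup>N lborel g * indicator {-3..3::real} t \<partial>lborel)"
  proof (rule nn_integral_mono)
    fix t :: real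
    show "(\<integral>\<^sup>+z. indicator shell z * g (t *\<^sub>R z) \<partial>lborel)
        \<le> ennreal (2 ^ CARD('n)) * integral\<^sup>N lborel g * indicator {-3..3} t"
    proof (cases "1/2 < \<bar>t\<bar> \<and> \<bar>t\<bar> < 3")
      case True
      have "(\<integral>\<^sup>+z. indicator shell z * g (t *\<^sub>R z) \<partial>lborel) \<le> (\<integral>\<^sup>+z. g (t *\<^sub>R z) \<partial>lborel)"
        by (intro nn_integral_mono) (auto simp: indicator_def)
      also have "\<dots> \<le> ennreal (2 ^ CARD('n)) * (ennreal (\<bar>t\<bar> ^ CARD('n)) * (\<integral>\<^sup>+z. g (t *\<^sub>R z) \<partial>lborel))"
      proof -
        have "1 \<le> 2 ^ CARD('n) * \<bar>t\<bar> ^ CARD('n)"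
          using True by (subst power_mult_distrib[symmetric], intro one_le_power) auto
        then have "1 \<le> ennreal (2 ^ CARD('n)) * ennreal (\<bar>t\<bar> ^ CARD('n))"
          by (simp add: ennreal_mult'[symmetric])
        from mult_right_mono[OF this, of "\<integral>\<^sup>+z. g (t *\<^sub>R z) \<partial>lborel"] show ?thesis
          by (simp add: mult.assoc)
      qed
      also have "\<dots> = ennreal (2 ^ CARD('n)) * integral\<^sup>N lborel g"
        using True by (subst nn_integral_scaleR[of g t]) auto
      finally show ?thesis
        using True by (auto simp: indicator_def)
    next
      case False
      have "indicator shell z * g (t *\<^sub>R z) = 0" for z
      proof (rule ccontr)
        assume "\<not> ?thesis"
        then have z: "1 < norm z" "norm z < 2" "1 < \<bar>t\<bar> * norm z" "\<bar>t\<bar> * norm z < 3"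
          by (auto simp: g_def indicator_def shell_def annulus_def split: if_splits)
        have "\<bar>t\<bar> * norm z \<le> \<bar>t\<bar> * 2" "\<bar>t\<bar> * 1 \<le> \<bar>t\<bar> * norm z"
          using z by (intro mult_left_mono; simp)+
        with z False show False by auto
      qed
      then show ?thesis by (simp only: nn_integral_const) simp
    qed
  qed
  also have "\<dots> = ennreal (2 ^ CARD('n)) * integral\<^sup>N lborel g * ennreal 6"
    by (subst nn_integral_cmult_indicator) auto
  also have "\<dots> = ennreal (6 * 2 ^ CARD('n)) * integral\<^sup>N lborel g"
    by (simp add: ennreal_mult' mult_ac)
  finally show ?thesis unfolding g_def .
qed

text \<open>Cauchy--Schwarz, obtained by integrating \<open>(f' - m)\<^sup>2 \<ge> 0\<close> with \<open>m\<close> the mean slope.\<close>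

lemma square_increment_le:
  fixes f f' :: "real \<Rightarrow> real"
  assumes "a < b" and d: "\<And>t. (f has_real_derivative f' t) (at t)" and c: "continuous_on {a..b} f'"
  shows "(f b - f a)\<^sup>2 \<le> (b - a) * integral {a..b} (\<lambda>t. (f' t)\<^sup>2)"
proof -
  define m where "m = (f b - f a) / (b - a)"
  have "((\<lambda>t. 2 * m * f' t - m\<^sup>2) has_integral ((2 * m * f b - m\<^sup>2 * b) - (2 * m * f a - m\<^sup>2 * a))) {a..b}"
  proof (rule fundamental_theorem_of_calculus)
    fix t
    have "((\<lambda>t. 2 * m * f t - m\<^sup>2 * t) has_real_derivative 2 * m * f' t - m\<^sup>2 * 1) (at t)"
      by (intro DERIV_diff DERIV_cmult d DERIV_ident)
    then show "((\<lambda>t. 2 * m * f t - m\<^sup>2 * t) has_vector_derivative 2 * m * f' t - m\<^sup>2) (at t within {a..b})"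
      by (simp add: has_real_derivative_iff_has_vector_derivative has_vector_derivative_at_within)
  qed (use \<open>a < b\<close> in simp)
  moreover have "((\<lambda>t. (f' t)\<^sup>2) has_integral integral {a..b} (\<lambda>t. (f' t)\<^sup>2)) {a..b}"
    by (intro integrable_integral integrable_continuous_real continuous_intros c)
  moreover have "2 * m * f' t - m\<^sup>2 \<le> (f' t)\<^sup>2" for t
    using zero_le_power2[of "f' t - m"] by (simp add: power2_diff algebra_simps)
  ultimately have "(2 * m * f b - m\<^sup>2 * b) - (2 * m * f a - m\<^sup>2 * a) \<le> integral {a..b} (\<lambda>t. (f' t)\<^sup>2)"
    by (rule has_integral_le)
  moreover have "(2 * m * f b - m\<^sup>2 * b) - (2 * m * f a - m\<^sup>2 * a) = 2 * m * (f b - f a) - m * (m * (b - a))"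
    by (simp add: algebra_simps power2_eq_square)
  moreover have m: "m * (b - a) = f b - f a"
    using \<open>a < b\<close> by (simp add: m_def)
  ultimately have "m * (f b - f a) \<le> integral {a..b} (\<lambda>t. (f' t)\<^sup>2)"
    by simp
  then have "(b - a) * (m * (f b - f a)) \<le> (b - a) * integral {a..b} (\<lambda>t. (f' t)\<^sup>2)"
    using \<open>a < b\<close> by (intro mult_left_mono) auto
  moreover have "(b - a) * (m * (f b - f a)) = (f b - f a)\<^sup>2"
    by (metis m mult.assoc mult.commute power2_eq_square)
  ultimately show ?thesis by simp
qed

text \<open>The derivative of t to f(t z) is the inner product of the gradient with z, hence the
  factor \<open>(norm z)\<^sup>2\<close>. The endpoints may be arbitrary because the gradient of a
  test function vanishes off the annulus.\<close>

lemma ray_increment_le: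
  fixes f :: "real^'n \<Rightarrow> real"
  assumes f: "test_fun annulus f" and ab: "a < b"
  shows "ennreal ((f (b *\<^sub>R z) - f (a *\<^sub>R z))\<^sup>2) \<le> ennreal ((b - a) * (norm z)\<^sup>2) * ray_energy (grad f) z"
proof -
  have s: "smooth f" using f by (simp add: test_fun_def)
  define h where "h t = grad f (t *\<^sub>R z) \<bullet> z" for t
  have d: "((\<lambda>t. f (t *\<^sub>R z)) has_real_derivative h t) (at t)" for t
  proof -
    have "((\<lambda>t. t *\<^sub>R z) has_derivative (\<lambda>v. v *\<^sub>R z)) (at t)"
      by (auto intro!: derivative_eq_intros)
    from has_derivative_compose[OF this has_derivative_grad[OF smooth_differentiable[OF s]]]
    show ?thesis by (simp add: has_field_derivative_def h_def mult_commute_abs)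
  qed
  have c: "continuous_on UNIV h"
    unfolding h_def
    by (intro continuous_intros continuous_on_compose2[OF smooth_continuous_grad[OF s]]) auto
  then have [measurable]: "h \<in> borel_measurable borel"
    by (rule borel_measurable_continuous_onI)
  have "(\<integral>\<^sup>+t. ennreal (indicator {a..b} t * (h t)\<^sup>2) \<partial>lborel) = ennreal (integral {a..b} (\<lambda>t. (h t)\<^sup>2))"
  proof -
    have "((\<lambda>t. (h t)\<^sup>2) has_integral integral {a..b} (\<lambda>t. (h t)\<^sup>2)) {a..b}"
      by (intro integrable_integral integrable_continuous_real continuous_intros
          continuous_on_subset[OF c]) auto
    then show ?thesis
      using nn_integral_has_integral_lebesgue[of "{a..b}" "\<lambda>t. (h t)\<^sup>2"]
      by (simp add: nn_integral_completion)
  qed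
  then have "ennreal (integral {a..b} (\<lambda>t. (h t)\<^sup>2)) = (\<integral>\<^sup>+t. ennreal (indicator {a..b} t * (h t)\<^sup>2) \<partial>lborel)"
    by simp
  also have "\<dots> \<le> (\<integral>\<^sup>+t. ennreal ((norm z)\<^sup>2) * (indicator annulus (t *\<^sub>R z) * ennreal ((norm (grad f (t *\<^sub>R z)))\<^sup>2)) \<partial>lborel)"
  proof (rule nn_integral_mono)
    fix t
    show "ennreal (indicator {a..b} t * (h t)\<^sup>2)
      \<le> ennreal ((norm z)\<^sup>2) * (indicator annulus (t *\<^sub>R z) * ennreal ((norm (grad f (t *\<^sub>R z)))\<^sup>2))"
    proof (cases "t *\<^sub>R z \<in> annulus")
      case True
      have "\<bar>h t\<bar> \<le> norm z * norm (grad f (t *\<^sub>R z))"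
        unfolding h_def using Cauchy_Schwarz_ineq2[of "grad f (t *\<^sub>R z)" z] by (simp add: mult.commute)
      then have "(h t)\<^sup>2 \<le> (norm z)\<^sup>2 * (norm (grad f (t *\<^sub>R z)))\<^sup>2"
        by (metis abs_ge_zero power2_abs power_mono power_mult_distrib)
      then show ?thesis
        using True by (auto simp: indicator_def ennreal_mult'[symmetric] intro!: ennreal_leI)
    next
      case False
      then have "grad f (t *\<^sub>R z) = 0"
        using f by (intro grad_zero_outside) (auto simp: test_fun_def)
      then show ?thesis by (simp add: h_def)
    qed
  qed
  also have "\<dots> = ennreal ((norm z)\<^sup>2) * ray_energy (grad f) z"
  proof -
    have [measurable]: "grad f \<in> borel_measurable borel"
      by (rule test_fun_measurable[OF f])
    show ?thesis
      unfolding ray_energy_def by (rule nn_integral_cmult) measurable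
  qed
  finally have le: "ennreal (integral {a..b} (\<lambda>t. (h t)\<^sup>2)) \<le> ennreal ((norm z)\<^sup>2) * ray_energy (grad f) z" .
  have "ennreal ((f (b *\<^sub>R z) - f (a *\<^sub>R z))\<^sup>2) \<le> ennreal ((b - a) * integral {a..b} (\<lambda>t. (h t)\<^sup>2))"
    by (intro ennreal_leI square_increment_le[OF ab d] continuous_on_subset[OF c]) auto
  also have "\<dots> = ennreal (b - a) * ennreal (integral {a..b} (\<lambda>t. (h t)\<^sup>2))"
    using ab by (simp add: ennreal_mult')
  also have "\<dots> \<le> ennreal (b - a) * (ennreal ((norm z)\<^sup>2) * ray_energy (grad f) z)"
    by (rule mult_left_mono[OF le]) auto
  also have "\<dots> = ennreal ((b - a) * (norm z)\<^sup>2) * ray_energy (grad f) z"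
    using ab by (simp add: ennreal_mult' mult.assoc)
  finally show ?thesis .
qed

text \<open>The increment is taken from the nearer boundary point of the ray, at parameter 1/|z| or
  3/|z|, where \<open>f\<close> vanishes.\<close>

lemma test_fun_ray_le:
  fixes f :: "real^'n \<Rightarrow> real"
  assumes f: "test_fun annulus f" and z: "z \<in> shell" and t: "t > 0" "t *\<^sub>R z \<in> annulus"
  shows "ennreal ((f (t *\<^sub>R z))\<^sup>2) \<le> ennreal (2 * (1 - \<bar>t * norm z - 2\<bar>)) * ray_energy (grad f) z"
proof -
  have zero: "f x = 0" if "x \<notin> annulus" for x
    using f that closure_subset[of "{x. f x \<noteq> 0}"] by (auto simp: test_fun_def)
  have nz: "1 < norm z" "norm z < 2" "0 < norm z" using z by (auto simp: shell_def)
  have r: "1 < t * norm z" "t * norm z < 3" using t by (auto simp: annulus_def)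
  have "f ((1 / norm z) *\<^sub>R z) = 0" "f ((3 / norm z) *\<^sub>R z) = 0"
    using nz by (intro zero; auto simp: annulus_def split: if_splits)+
  \<comment> \<open>A parameter interval of length e covers the distance d = e |z|, so e |z|^2 = d
    |z| is at most 2 d on the shell. This is the origin of the factor 2.\<close>
  have *: "ennreal ((f (t *\<^sub>R z))\<^sup>2) \<le> ennreal (2 * d) * ray_energy (grad f) z"
    if "ennreal ((f (t *\<^sub>R z))\<^sup>2) \<le> ennreal (e * (norm z)\<^sup>2) * ray_energy (grad f) z"
      and "e * norm z = d" "0 < d" for d e
  proof -
    have "e * (norm z)\<^sup>2 = d * norm z" using that by (simp add: power2_eq_square)
    also have "\<dots> \<le> 2 * d" using nz \<open>0 < d\<close> by simp
    finally have "ennreal (e * (norm z)\<^sup>2) * ray_energy (grad f) z \<le> ennreal (2 * d) * ray_energy (grad f) z"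
      by (intro mult_right_mono ennreal_leI) auto
    with that(1) show ?thesis by (rule order_trans)
  qed
  show ?thesis
  proof (cases "t * norm z \<le> 2")
    case True
    have "ennreal ((f (t *\<^sub>R z))\<^sup>2) \<le> ennreal (2 * (t * norm z - 1)) * ray_energy (grad f) z"
    proof (rule *)
      have "1 / norm z < t" using r nz by (simp add: pos_divide_less_eq)
      from ray_increment_le[OF f this, of z]
      show "ennreal ((f (t *\<^sub>R z))\<^sup>2) \<le> ennreal ((t - 1 / norm z) * (norm z)\<^sup>2) * ray_energy (grad f) z"
        using \<open>f ((1 / norm z) *\<^sub>R z) = 0\<close> by simp
    qed (use r nz in \<open>auto simp: field_simps\<close>)
    with True show ?thesis by simp
  next
    case False
    have "ennreal ((f (t *\<^sub>R z))\<^sup>2) \<le> ennreal (2 * (3 - t * norm z)) * ray_energy (grad f) z"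
    proof (rule *)
      have "t < 3 / norm z" using r nz by (simp add: pos_less_divide_eq)
      from ray_increment_le[OF f this, of z]
      show "ennreal ((f (t *\<^sub>R z))\<^sup>2) \<le> ennreal ((3 / norm z - t) * (norm z)\<^sup>2) * ray_energy (grad f) z"
        using \<open>f ((3 / norm z) *\<^sub>R z) = 0\<close> by simp
    qed (use r nz in \<open>auto simp: field_simps\<close>)
    with False show ?thesis by simp
  qed
qed

text \<open>One half of polar coordinates, up to a constant. The integral is averaged over its
  rescalings by t in [1, 2], and for fixed z the substitution r = t |z| reduces it to one dimension.
  The constant collects t^N \<le> 2^N, the Jacobian 1/|z| \<le> 2, and the volume of the ball that
  contains all relevant z.\<close>

lemma nn_integral_annulus_radial_le:
  fixes h :: "real \<Rightarrow> ennreal"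
  assumes [measurable]: "h \<in> borel_measurable borel"
  shows "(\<integral>\<^sup>+x. indicator annulus (x::real^'n) * h (norm x) \<partial>lborel)
    \<le> ennreal (2 ^ Suc CARD('n) * measure lborel (ball (0::real^'n) 3)) * (\<integral>\<^sup>+r. indicator {1<..<3} r * h r \<partial>lborel)"
proof -
  define g where "g x = indicator annulus x * h (norm x)" for x :: "real^'n"
  define k where "k r = indicator {1<..<3} r * h r" for r
  have [measurable]: "g \<in> borel_measurable borel" "k \<in> borel_measurable borel"
    unfolding g_def k_def by measurable
  have scale: "integral\<^sup>N lborel g \<le> ennreal (2 ^ CARD('n)) * (\<integral>\<^sup>+z. g (t *\<^sub>R z) \<partial>lborel)" if "t \<in> {1..2}" for t
  proof -
    have "integral\<^sup>N lborel g = ennreal (\<bar>t\<bar> ^ CARD('n)) * (\<integral>\<^sup>+z. g (t *\<^sub>R z) \<partial>lborel)"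
      using that by (subst nn_integral_scaleR[of g t]) auto
    also have "\<dots> \<le> ennreal (2 ^ CARD('n)) * (\<integral>\<^sup>+z. g (t *\<^sub>R z) \<partial>lborel)"
      using that by (intro mult_right_mono ennreal_leI power_mono) auto
    finally show ?thesis .
  qed
  \<comment> \<open>The interval [1, 2] has length 1, so averaging over it leaves the value
    unchanged.\<close>
  have "integral\<^sup>N lborel g = (\<integral>\<^sup>+t. integral\<^sup>N lborel g * indicator {1..2::real} t \<partial>lborel)"
    by (subst nn_integral_cmult_indicator) auto
  also have "\<dots> \<le> (\<integral>\<^sup>+t. ennreal (2 ^ CARD('n)) * (\<integral>\<^sup>+z. indicator {1..2::real} t * g (t *\<^sub>R z) \<partial>lborel) \<partial>lborel)"
    using scale by (intro nn_integral_mono) (auto simp: indicator_def)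
  also have "\<dots> = ennreal (2 ^ CARD('n)) * (\<integral>\<^sup>+t. \<integral>\<^sup>+z. indicator {1..2::real} t * g (t *\<^sub>R z) \<partial>lborel \<partial>lborel)"
    by (rule nn_integral_cmult) measurable
  also have "(\<integral>\<^sup>+t. \<integral>\<^sup>+z. indicator {1..2::real} t * g (t *\<^sub>R z) \<partial>lborel \<partial>lborel)
      = (\<integral>\<^sup>+z. \<integral>\<^sup>+t. indicator {1..2::real} t * g (t *\<^sub>R z) \<partial>lborel \<partial>lborel)"
    by (rule lborel_pair.Fubini') measurable
  finally have le: "integral\<^sup>N lborel g
      \<le> ennreal (2 ^ CARD('n)) * (\<integral>\<^sup>+z. \<integral>\<^sup>+t. indicator {1..2::real} t * g (t *\<^sub>R z) \<partial>lborel \<partial>lborel)" .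
  have "(\<integral>\<^sup>+z. \<integral>\<^sup>+t. indicator {1..2::real} t * g (t *\<^sub>R z) \<partial>lborel \<partial>lborel)
      \<le> (\<integral>\<^sup>+z. (2 * integral\<^sup>N lborel k) * indicator (ball (0::real^'n) 3) z \<partial>lborel)"
  proof (rule nn_integral_mono)
    fix z :: "real^'n"
    show "(\<integral>\<^sup>+t. indicator {1..2::real} t * g (t *\<^sub>R z) \<partial>lborel)
      \<le> (2 * integral\<^sup>N lborel k) * indicator (ball 0 3) z"
    proof (cases "1/2 < norm z \<and> norm z < 3")
      case True
      have "(\<integral>\<^sup>+t. indicator {1..2::real} t * g (t *\<^sub>R z) \<partial>lborel) \<le> (\<integral>\<^sup>+t. k (0 + norm z * t) \<partial>lborel)"
        by (intro nn_integral_mono)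
          (auto simp: indicator_def g_def k_def annulus_def mult.commute)
      also have "\<dots> \<le> 2 * (ennreal \<bar>norm z\<bar> * (\<integral>\<^sup>+t. k (0 + norm z * t) \<partial>lborel))"
      proof -
        have "ennreal 1 \<le> ennreal (2 * \<bar>norm z\<bar>)"
          using True by (intro ennreal_leI) auto
        then have "1 \<le> 2 * ennreal \<bar>norm z\<bar>"
          by (simp add: ennreal_mult')
        from mult_right_mono[OF this, of "\<integral>\<^sup>+t. k (0 + norm z * t) \<partial>lborel"] show ?thesis
          by (simp add: mult.assoc)
      qed
      also have "\<dots> = 2 * integral\<^sup>N lborel k"
        using True by (subst nn_integral_real_affine[of k "norm z" 0]) auto
      finally show ?thesis
        using True by (auto simp: indicator_def)
    next
      case False
      have "indicator {1..2::real} t * g (t *\<^sub>R z) = 0" for t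
      proof (rule ccontr)
        assume "\<not> ?thesis"
        then have t: "1 \<le> t" "t \<le> 2" "1 < t * norm z" "t * norm z < 3"
          by (auto simp: g_def indicator_def annulus_def split: if_splits)
        have "t * norm z \<le> 2 * norm z" "1 * norm z \<le> t * norm z"
          using t by (intro mult_right_mono; simp)+
        with t False show False by auto
      qed
      then show ?thesis by (simp only: nn_integral_const) simp
    qed
  qed
  also have "\<dots> = 2 * integral\<^sup>N lborel k * ennreal (measure lborel (ball (0::real^'n) 3))"
    using emeasure_bounded_finite[OF bounded_ball, of "0::real^'n" 3]
    by (subst nn_integral_cmult_indicator) (auto simp: emeasure_eq_ennreal_measure)
  finally have "integral\<^sup>N lborel g \<le> ennreal (2 ^ CARD('n)) * (2 * integral\<^sup>N lborel k * ennreal (measure lborel (ball (0::real^'n) 3)))"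
    by (intro order_trans[OF le] mult_left_mono) auto
  also have "\<dots> = ennreal (2 ^ Suc CARD('n) * measure lborel (ball (0::real^'n) 3)) * integral\<^sup>N lborel k"
    by (simp add: ennreal_mult' mult_ac)
  finally show ?thesis unfolding g_def k_def .
qed

text \<open>The preceding radial estimate, applied to the indicator of a null set of radii, shows
  that the corresponding union of spheres is null.\<close>

lemma AE_annulus_norm:
  assumes "AE r in lborel. Q r"
  shows "AE x in lborel. (x::real^'n) \<in> annulus \<longrightarrow> Q (norm x)"
proof -
  obtain M where M: "{x. \<not> Q x} \<subseteq> M" "M \<in> null_sets lborel"
    using assms by (auto simp: eventually_ae_filter)
  have [measurable]: "M \<in> sets borel"
    using M(2) by auto
  have "AE r in lborel. indicator {1<..<3} r * indicator M r = (0::ennreal)"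
    using AE_not_in[OF M(2)] by (auto elim: eventually_mono)
  then have "(\<integral>\<^sup>+r. indicator {1<..<3} r * indicator M r \<partial>lborel) = 0"
    by (subst nn_integral_0_iff_AE) auto
  with nn_integral_annulus_radial_le[of "indicator M", where 'n='n]
  have "(\<integral>\<^sup>+x. indicator annulus (x::real^'n) * indicator M (norm x) \<partial>lborel) = 0"
    by simp
  then have "AE x in lborel. indicator annulus (x::real^'n) * indicator M (norm x) = (0::ennreal)"
    by (subst (asm) nn_integral_0_iff_AE) auto
  then show ?thesis
    by eventually_elim (use M(1) in \<open>auto simp: indicator_def split: if_splits\<close>)
qed

section \<open>The one-dimensional weight integral\<close>

lemma nn_integral_powr_exp:
  assumes "\<alpha> > 0" "q > 0"
  shows "(\<integral>\<^sup>+s. ennreal (indicator {0..} s * (s powr q * exp (- (\<alpha> * s)))) \<partial>lborel)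
    = ennreal (Gamma (q + 1) * \<alpha> powr (- (q + 1)))"
proof -
  define k where "k s = ennreal (indicator {0..} s * s powr q / exp s)" for s :: real
  have [measurable]: "k \<in> borel_measurable borel"
    unfolding k_def by measurable
  have G: "integral\<^sup>N lborel k = ennreal (Gamma (q + 1))"
    using Gamma_conv_nn_integral_real[of "q + 1"] assms by (simp add: k_def[abs_def])
  have "ennreal (indicator {0..} s * (s powr q * exp (- (\<alpha> * s)))) = ennreal (\<alpha> powr (- q)) * k (0 + \<alpha> * s)" for s
    using assms by (cases "s \<ge> 0")
      (auto simp: k_def indicator_def zero_le_mult_iff ennreal_mult'[symmetric] powr_mult powr_minus
        exp_minus field_simps intro!: arg_cong[of _ _ ennreal])
  then have "(\<integral>\<^sup>+s. ennreal (indicator {0..} s * (s powr q * exp (- (\<alpha> * s)))) \<partial>lborel)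
     = ennreal (\<alpha> powr (- q)) * (\<integral>\<^sup>+s. k (0 + \<alpha> * s) \<partial>lborel)"
    by (simp add: nn_integral_cmult)
  also have "(\<integral>\<^sup>+s. k (0 + \<alpha> * s) \<partial>lborel) = ennreal (1 / \<alpha>) * integral\<^sup>N lborel k"
    using assms by (subst nn_integral_real_affine[of k \<alpha> 0])
      (auto simp: mult.assoc[symmetric] ennreal_mult'[symmetric])
  also have "ennreal (\<alpha> powr (- q)) * (ennreal (1 / \<alpha>) * integral\<^sup>N lborel k) = ennreal (Gamma (q + 1) * \<alpha> powr (- (q + 1)))"
  proof -
    have "\<alpha> powr (- (q + 1)) = \<alpha> powr (- q) * (1 / \<alpha>)"
      using assms powr_diff[of \<alpha> "- q" 1] by simp
    then show ?thesis
      unfolding G using assms by (simp add: ennreal_mult'[symmetric])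
  qed
  finally show ?thesis .
qed

text \<open>This is ln s \<le> s - 1. With s = 1 - d it bounds the weight by exp(-\<alpha> d), which
  makes a Gamma integral of the weight integral.\<close>

lemma powr_le_exp: "0 \<le> s \<Longrightarrow> 0 < \<alpha> \<Longrightarrow> s powr \<alpha> \<le> exp (- (\<alpha> * (1 - s)))" for s \<alpha> :: real
proof (cases "s = 0")
  case False
  assume "0 \<le> s" "0 < \<alpha>"
  with False have "\<alpha> * ln s \<le> \<alpha> * (s - 1)"
    by (intro mult_left_mono ln_le_minus_one) auto
  with False show ?thesis by (simp add: powr_def algebra_simps)
qed simp

lemma nn_integral_weight_le:
  assumes "\<alpha> > 0" "q > 0"
  shows "(\<integral>\<^sup>+r. indicator {1<..<3} r * ennreal (\<bar>r - 2\<bar> powr \<alpha> * (1 - \<bar>r - 2\<bar>) powr q) \<partial>lborel)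
    \<le> ennreal (2 * Gamma (q + 1) * \<alpha> powr (- (q + 1)))"
proof -
  define k where "k s = ennreal (indicator {0..} s * (s powr q * exp (- (\<alpha> * s))))" for s :: real
  have [measurable]: "k \<in> borel_measurable borel"
    unfolding k_def by measurable
  have k: "integral\<^sup>N lborel k = ennreal (Gamma (q + 1) * \<alpha> powr (- (q + 1)))"
    unfolding k_def by (rule nn_integral_powr_exp[OF assms])
  \<comment> \<open>The two arguments of \<open>k\<close> are the distances to the outer and the
    inner sphere. The smaller one is the distance to the boundary, and the other term is
    nonnegative; each term integrates to the same Gamma value.\<close>
  have "indicator {1<..<3} r * ennreal (\<bar>r - 2\<bar> powr \<alpha> * (1 - \<bar>r - 2\<bar>) powr q)
      \<le> k (3 + (-1) * r) + k (-1 + 1 * r)" for r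
  proof (cases "1 < r \<and> r < 3")
    case True
    define d where "d = 1 - \<bar>r - 2\<bar>"
    have "d > 0" using True by (auto simp: d_def)
    have "\<bar>r - 2\<bar> powr \<alpha> * d powr q \<le> d powr q * exp (- (\<alpha> * d))"
      using powr_le_exp[of "\<bar>r - 2\<bar>" \<alpha>] assms
      by (subst mult.commute) (auto simp: d_def intro!: mult_left_mono)
    then have "ennreal (\<bar>r - 2\<bar> powr \<alpha> * d powr q) \<le> k d"
      using \<open>d > 0\<close> by (simp add: k_def ennreal_leI)
    moreover have "k d = k (3 + (-1) * r) \<or> k d = k (-1 + 1 * r)"
      by (cases "r \<le> 2") (auto simp: d_def)
    then have "k d \<le> k (3 + (-1) * r) + k (-1 + 1 * r)"
      by auto
    ultimately show ?thesis
      using True unfolding d_def by (auto simp: indicator_def intro: order_trans)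
  qed auto
  then have "(\<integral>\<^sup>+r. indicator {1<..<3} r * ennreal (\<bar>r - 2\<bar> powr \<alpha> * (1 - \<bar>r - 2\<bar>) powr q) \<partial>lborel)
    \<le> (\<integral>\<^sup>+r. k (3 + (-1) * r) + k (-1 + 1 * r) \<partial>lborel)"
    by (intro nn_integral_mono)
  also have "\<dots> = (\<integral>\<^sup>+r. k (3 + (-1) * r) \<partial>lborel) + (\<integral>\<^sup>+r. k (-1 + 1 * r) \<partial>lborel)"
    by (intro nn_integral_add) auto
  also have "\<dots> = integral\<^sup>N lborel k + integral\<^sup>N lborel k"
    using nn_integral_real_affine[of k "-1" 3] nn_integral_real_affine[of k 1 "-1"] by simp
  also have "\<dots> = ennreal (2 * Gamma (q + 1) * \<alpha> powr (- (q + 1)))"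
    unfolding k using assms Gamma_real_nonneg[of "q + 1"] by (simp add: ennreal_plus[symmetric] del: ennreal_plus)
  finally show ?thesis .
qed

section \<open>Lower bound for radial functions\<close>

lemma integrable_power2_diff:
  fixes f g :: "'a \<Rightarrow> 'b::euclidean_space"
  assumes [measurable]: "f \<in> borel_measurable M" "g \<in> borel_measurable M"
    and f: "integrable M (\<lambda>x. (norm (f x))\<^sup>2)" and g: "integrable M (\<lambda>x. (norm (g x))\<^sup>2)"
  shows "integrable M (\<lambda>x. (norm (f x - g x))\<^sup>2)"
proof (rule Bochner_Integration.integrable_bound)
  show "integrable M (\<lambda>x. 2 * (norm (f x))\<^sup>2 + 2 * (norm (g x))\<^sup>2)"
    using f g by auto
  have "(norm (f x - g x))\<^sup>2 \<le> 2 * (norm (f x))\<^sup>2 + 2 * (norm (g x))\<^sup>2" for x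
  proof -
    have "(norm (f x - g x))\<^sup>2 \<le> (norm (f x) + norm (g x))\<^sup>2"
      by (intro power_mono norm_triangle_ineq4) auto
    also have "\<dots> \<le> 2 * (norm (f x))\<^sup>2 + 2 * (norm (g x))\<^sup>2"
      using sum_squares_bound[of "norm (f x)" "norm (g x)"] by (simp add: power2_sum)
    finally show ?thesis .
  qed
  then show "AE x in M. norm ((norm (f x - g x))\<^sup>2) \<le> norm (2 * (norm (f x))\<^sup>2 + 2 * (norm (g x))\<^sup>2)"
    by auto
qed measurable

text \<open>Turns L^2 convergence of gradients into an energy bound for the approximants. The
  elementary inequality |a + b|^2 \<le> 2 |a|^2 + 2 |b|^2 suffices, at the cost of a factor
  2.\<close>

lemma nn_integral_annulus_energy_le:
  fixes F G :: "real^'n \<Rightarrow> real^'n"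
  assumes [measurable]: "F \<in> borel_measurable borel" "G \<in> borel_measurable borel"
    and F: "integrable lborel (\<lambda>x. (norm (F x))\<^sup>2)" and G: "integrable lborel (\<lambda>x. (norm (G x))\<^sup>2)"
  shows "(\<integral>\<^sup>+x. indicator annulus x * ennreal ((norm (F x))\<^sup>2) \<partial>lborel)
    \<le> ennreal (2 * (LINT x:annulus|lborel. (norm (G x))\<^sup>2) + 2 * (\<integral>x. (norm (F x - G x))\<^sup>2 \<partial>lborel))"
proof -
  have i: "integrable lborel (\<lambda>x. (norm (F x - G x))\<^sup>2)"
    using integrable_power2_diff[of F lborel G] F G by simp
  have j: "integrable lborel (\<lambda>x. indicator annulus x *\<^sub>R (norm (G x))\<^sup>2)"
    by (rule integrable_mult_indicator[OF _ G]) simp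
  let ?h = "\<lambda>x. 2 * (indicator annulus x *\<^sub>R (norm (G x))\<^sup>2) + 2 * (norm (F x - G x))\<^sup>2"
  have "(\<integral>\<^sup>+x. indicator annulus x * ennreal ((norm (F x))\<^sup>2) \<partial>lborel) \<le> (\<integral>\<^sup>+x. ennreal (?h x) \<partial>lborel)"
  proof (rule nn_integral_mono)
    fix x
    have "(norm (F x))\<^sup>2 \<le> (norm (G x) + norm (F x - G x))\<^sup>2"
      using norm_triangle_ineq[of "G x" "F x - G x"] by (intro power_mono) auto
    also have "\<dots> \<le> 2 * (norm (G x))\<^sup>2 + 2 * (norm (F x - G x))\<^sup>2"
      using sum_squares_bound[of "norm (G x)" "norm (F x - G x)"] by (simp add: power2_sum)
    finally show "indicator annulus x * ennreal ((norm (F x))\<^sup>2) \<le> ennreal (?h x)"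
      by (auto simp: indicator_def simp del: ennreal_plus intro!: ennreal_leI)
  qed
  also have "\<dots> = ennreal (\<integral>x. ?h x \<partial>lborel)"
    using i j by (intro nn_integral_eq_integral) auto
  also have "(\<integral>x. ?h x \<partial>lborel) = 2 * (LINT x:annulus|lborel. (norm (G x))\<^sup>2) + 2 * (\<integral>x. (norm (F x - G x))\<^sup>2 \<partial>lborel)"
    using i j by (simp add: set_lebesgue_integral_def)
  finally show ?thesis .
qed

text \<open>Convergence of the squared differences in L^1 has an a.e. convergent subsequence, and
  the gradients keep their limit along it. This supplies the pointwise values that ray estimates
  need.\<close>

lemma H10_grad_AE_approx:
  fixes u :: "real^'n \<Rightarrow> real"
  assumes "H10_grad U u G"
  obtains \<psi> where "\<And>k. test_fun U (\<psi> k)"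
    "AE x in lborel. (\<lambda>k. \<psi> k x) \<longlonglongrightarrow> u x"
    "(\<lambda>k. \<integral>x. (norm (grad (\<psi> k) x - G x))\<^sup>2 \<partial>lborel) \<longlonglongrightarrow> 0"
proof -
  obtain \<phi> where \<phi>: "\<And>k. test_fun U (\<phi> k)"
    and lim: "(\<lambda>k. \<integral>x. (\<phi> k x - u x)\<^sup>2 \<partial>lborel) \<longlonglongrightarrow> 0"
    and limG: "(\<lambda>k. \<integral>x. (norm (grad (\<phi> k) x - G x))\<^sup>2 \<partial>lborel) \<longlonglongrightarrow> 0"
    using assms unfolding H10_grad_def by blast
  have u: "u \<in> borel_measurable lborel" "integrable lborel (\<lambda>x. (u x)\<^sup>2)"
    using assms unfolding H10_grad_def by auto
  have int: "integrable lborel (\<lambda>x. (\<phi> k x - u x)\<^sup>2)" for k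
    using integrable_power2_diff[of "\<phi> k" lborel u] u test_fun_measurable[OF \<phi>]
      test_fun_integrable[OF \<phi>] by simp
  have "\<exists>r::nat\<Rightarrow>nat. strict_mono r \<and> (AE x in lborel. (\<lambda>n. (\<phi> (r n) x - u x)\<^sup>2) \<longlonglongrightarrow> 0)"
    using int lim by (intro tendsto_L1_AE_subseq) auto
  then obtain r :: "nat \<Rightarrow> nat" where r: "strict_mono r"
    and ae: "AE x in lborel. (\<lambda>n. (\<phi> (r n) x - u x)\<^sup>2) \<longlonglongrightarrow> 0"
    by blast
  show thesis
  proof (rule that[of "\<lambda>n. \<phi> (r n)"])
    show "AE x in lborel. (\<lambda>k. \<phi> (r k) x) \<longlonglongrightarrow> u x"
      using ae
    proof eventually_elim
      case (elim x)
      then have "(\<lambda>n. sqrt ((\<phi> (r n) x - u x)\<^sup>2)) \<longlonglongrightarrow> sqrt 0"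
        by (rule tendsto_real_sqrt)
      then have "(\<lambda>n. \<phi> (r n) x - u x) \<longlonglongrightarrow> 0"
        by (simp add: tendsto_rabs_zero_iff)
      then show ?case by (simp add: LIM_zero_iff)
    qed
    show "(\<lambda>k. \<integral>x. (norm (grad (\<phi> (r k)) x - G x))\<^sup>2 \<partial>lborel) \<longlonglongrightarrow> 0"
      using LIMSEQ_subseq_LIMSEQ[OF limG r] by (simp add: comp_def)
  qed (rule \<phi>)
qed

text \<open>Fatou's lemma followed by the averaged energy bound; 12 is 6 times the factor 2 from the
  energy comparison. The energies need not converge on a given ray, but a small lower limit already
  yields infinitely many good approximants.\<close>

lemma liminf_ray_energy_le:
  fixes G :: "real^'n \<Rightarrow> real^'n"
  assumes \<psi>: "\<And>k. test_fun annulus (\<psi> k)"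
    and lim: "(\<lambda>k. \<integral>x. (norm (grad (\<psi> k) x - G x))\<^sup>2 \<partial>lborel) \<longlonglongrightarrow> 0"
    and [measurable]: "G \<in> borel_measurable borel" and G: "integrable lborel (\<lambda>x. (norm (G x))\<^sup>2)"
  shows "(\<integral>\<^sup>+z. indicator shell z * liminf (\<lambda>k. ray_energy (grad (\<psi> k)) z) \<partial>lborel)
    \<le> ennreal (12 * 2 ^ CARD('n) * (LINT x:annulus|lborel. (norm (G x))\<^sup>2))"
proof -
  have [measurable]: "grad (\<psi> k) \<in> borel_measurable borel" for k
    by (rule test_fun_measurable[OF \<psi>])
  define D where "D = (LINT x:annulus|lborel. (norm (G x))\<^sup>2)"
  define e where "e k = (\<integral>x. (norm (grad (\<psi> k) x - G x))\<^sup>2 \<partial>lborel)" for k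
  have "(\<integral>\<^sup>+z. indicator shell z * liminf (\<lambda>k. ray_energy (grad (\<psi> k)) z) \<partial>lborel)
      \<le> (\<integral>\<^sup>+z. liminf (\<lambda>k. indicator shell z * ray_energy (grad (\<psi> k)) z) \<partial>lborel)"
    by (intro nn_integral_mono) (auto simp: indicator_def)
  also have "\<dots> \<le> liminf (\<lambda>k. \<integral>\<^sup>+z. indicator shell z * ray_energy (grad (\<psi> k)) z \<partial>lborel)"
    by (intro nn_integral_liminf) measurable
  also have "\<dots> \<le> liminf (\<lambda>k. ennreal (6 * 2 ^ CARD('n) * (2 * D + 2 * e k)))"
  proof (intro Liminf_mono always_eventually allI)
    fix k
    have "(\<integral>\<^sup>+z. indicator shell z * ray_energy (grad (\<psi> k)) z \<partial>lborel)
        \<le> ennreal (6 * 2 ^ CARD('n)) * (\<integral>\<^sup>+x. indicator annulus x * ennreal ((norm (grad (\<psi> k) x))\<^sup>2) \<partial>lborel)"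
      by (rule nn_integral_ray_energy_le) measurable
    also have "\<dots> \<le> ennreal (6 * 2 ^ CARD('n)) * ennreal (2 * D + 2 * e k)"
      unfolding D_def e_def
      by (intro mult_left_mono nn_integral_annulus_energy_le test_fun_integrable(2)[OF \<psi>] G) auto
    finally show "(\<integral>\<^sup>+z. indicator shell z * ray_energy (grad (\<psi> k)) z \<partial>lborel)
        \<le> ennreal (6 * 2 ^ CARD('n) * (2 * D + 2 * e k))"
      by (subst ennreal_mult') auto
  qed
  also have "\<dots> = ennreal (6 * 2 ^ CARD('n) * (2 * D + 2 * 0))"
    using lim unfolding e_def by (intro lim_imp_Liminf tendsto_intros) auto
  finally show ?thesis by (simp add: D_def mult.assoc)
qed

text \<open>The profile \<open>f\<close> of a radial function need not be measurable. It is therefore never integrated: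
  on a single good ray \<open>f\<close> agrees with \<open>u\<close> almost everywhere, and the bound found there carries over
  to all of the annulus.\<close>

lemma radial_pointwise_bound:
  fixes u :: "real^'n \<Rightarrow> real"
  assumes H: "H10_grad annulus u G" and rad: "radial u"
    and K: "24 * 2 ^ CARD('n) / measure lborel (shell :: (real^'n) set)
      * (LINT x:annulus|lborel. (norm (G x))\<^sup>2) < K"
  shows "AE x in lborel. x \<in> annulus \<longrightarrow> (u x)\<^sup>2 \<le> K * (1 - \<bar>norm x - 2\<bar>)"
proof -
  obtain f where f: "AE x in lborel. u x = f (norm x)"
    using rad by (auto simp: radial_def)
  have G: "G \<in> borel_measurable borel" "integrable lborel (\<lambda>x. (norm (G x))\<^sup>2)"
    using H by (auto simp: H10_grad_def)
  obtain \<psi> where \<psi>: "\<And>k. test_fun annulus (\<psi> k)"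
    and lim: "AE x in lborel. (\<lambda>k. \<psi> k x) \<longlonglongrightarrow> u x"
    and limG: "(\<lambda>k. \<integral>x. (norm (grad (\<psi> k) x - G x))\<^sup>2 \<partial>lborel) \<longlonglongrightarrow> 0"
    by (rule H10_grad_AE_approx[OF H]) blast
  have [measurable]: "grad (\<psi> k) \<in> borel_measurable borel" for k
    by (rule test_fun_measurable[OF \<psi>])
  define D where "D = (LINT x:annulus|lborel. (norm (G x))\<^sup>2)"
  have "D \<ge> 0"
    unfolding D_def set_lebesgue_integral_def by (intro integral_nonneg_AE) auto
  define V where "V = measure lborel (shell :: (real^'n) set)"
  have "V > 0" unfolding V_def by (rule measure_shell_pos)
  \<comment> \<open>The constant 24 is 12 doubled, because the target on a good ray is energy below
    K/2. Strictness is what later contradicts a lower limit of at least K/2 on almost all of the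
    shell, also when \<open>D\<close> is 0.\<close>
  have KV: "12 * 2 ^ CARD('n) * D < K / 2 * V"
    using K \<open>V > 0\<close> by (simp add: D_def[symmetric] V_def[symmetric] field_simps)
  then have "K > 0"
  proof -
    have "0 \<le> 12 * 2 ^ CARD('n) * D" using \<open>D \<ge> 0\<close> by simp
    with KV have "0 < K / 2 * V" by linarith
    with \<open>V > 0\<close> show ?thesis by (simp add: zero_less_mult_iff)
  qed
  define b where "b z = liminf (\<lambda>k. ray_energy (grad (\<psi> k)) z)" for z
  have "\<not> (AE z in lborel. z \<in> shell \<longrightarrow> ennreal (K / 2) \<le> b z)"
  proof
    assume "AE z in lborel. z \<in> shell \<longrightarrow> ennreal (K / 2) \<le> b z"
    then have "(\<integral>\<^sup>+z. ennreal (K / 2) * indicator (shell :: (real^'n) set) z \<partial>lborel)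
        \<le> (\<integral>\<^sup>+z. indicator shell z * b z \<partial>lborel)"
      by (intro nn_integral_mono_AE) (auto simp: indicator_def elim!: eventually_mono)
    also have "\<dots> \<le> ennreal (12 * 2 ^ CARD('n) * D)"
      unfolding b_def D_def by (rule liminf_ray_energy_le[OF \<psi> limG G])
    also have "(\<integral>\<^sup>+z. ennreal (K / 2) * indicator (shell :: (real^'n) set) z \<partial>lborel) = ennreal (K / 2 * V)"
      using \<open>K > 0\<close> by (subst nn_integral_cmult_indicator) (auto simp: emeasure_shell V_def ennreal_mult'[symmetric])
    finally show False
      using KV \<open>D \<ge> 0\<close> by (subst (asm) ennreal_le_iff) auto
  qed
  \<comment> \<open>Frequently with respect to the a.e. filter means on a non-null set, so such base
    points also meet every condition that holds almost everywhere.\<close>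
  then have "\<exists>\<^sub>F z in ae_filter lborel. z \<in> shell \<and> b z < ennreal (K / 2)"
    by (simp add: frequently_def not_less)
  moreover have "AE z in lborel. AE t in lborel. (\<lambda>k. \<psi> k (t *\<^sub>R z)) \<longlonglongrightarrow> u (t *\<^sub>R z)"
    by (rule AE_rays[OF lim])
  then have "AE z in lborel. (AE t in lborel. (\<lambda>k. \<psi> k (t *\<^sub>R z)) \<longlonglongrightarrow> u (t *\<^sub>R z))
      \<and> (AE t in lborel. u (t *\<^sub>R z) = f (norm (t *\<^sub>R z)))"
    using AE_rays[OF f] by eventually_elim simp
  ultimately have "\<exists>z. (z \<in> shell \<and> b z < ennreal (K / 2))
      \<and> (AE t in lborel. (\<lambda>k. \<psi> k (t *\<^sub>R z)) \<longlonglongrightarrow> u (t *\<^sub>R z))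
      \<and> (AE t in lborel. u (t *\<^sub>R z) = f (norm (t *\<^sub>R z)))"
    by (intro frequently_ex[OF frequently_eventually_frequently])
  then obtain z where z: "z \<in> shell" "b z < ennreal (K / 2)"
    and z1: "AE t in lborel. (\<lambda>k. \<psi> k (t *\<^sub>R z)) \<longlonglongrightarrow> u (t *\<^sub>R z)"
    and z2: "AE t in lborel. u (t *\<^sub>R z) = f (norm (t *\<^sub>R z))"
    by blast
  have nz: "norm z > 0" using z by (auto simp: shell_def)
  have freq: "\<exists>\<^sub>F k in sequentially. ray_energy (grad (\<psi> k)) z < ennreal (K / 2)"
  proof (rule ccontr)
    assume "\<not> ?thesis"
    then have "\<forall>\<^sub>F k in sequentially. ennreal (K / 2) \<le> ray_energy (grad (\<psi> k)) z"
      by (simp add: frequently_def not_less)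
    then have "ennreal (K / 2) \<le> b z"
      unfolding b_def by (rule Liminf_bounded)
    with z(2) show False by simp
  qed
  have "AE t in lborel. 1 < t * norm z \<and> t * norm z < 3 \<longrightarrow> (f (t * norm z))\<^sup>2 \<le> K * (1 - \<bar>t * norm z - 2\<bar>)"
    using z1 z2
  proof eventually_elim
    case (elim t)
    show ?case
    proof (rule impI, rule ccontr)
      assume r: "1 < t * norm z \<and> t * norm z < 3"
        and no: "\<not> (f (t * norm z))\<^sup>2 \<le> K * (1 - \<bar>t * norm z - 2\<bar>)"
      have "t > 0" using r nz zero_less_mult_pos2[of t "norm z"] by simp
      then have t: "t *\<^sub>R z \<in> annulus" using r by (simp add: annulus_def)
      define d where "d = 1 - \<bar>t * norm z - 2\<bar>"
      have "d > 0" using r by (auto simp: d_def)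
      have "K * d < (u (t *\<^sub>R z))\<^sup>2"
        using no elim(2) \<open>t > 0\<close> by (simp add: d_def)
      moreover have "(\<lambda>k. (\<psi> k (t *\<^sub>R z))\<^sup>2) \<longlonglongrightarrow> (u (t *\<^sub>R z))\<^sup>2"
        by (intro tendsto_intros elim(1))
      ultimately have "\<forall>\<^sub>F k in sequentially. K * d < (\<psi> k (t *\<^sub>R z))\<^sup>2"
        by (intro order_tendstoD)
      from frequently_ex[OF frequently_eventually_frequently[OF freq this]]
      obtain k where k: "ray_energy (grad (\<psi> k)) z < ennreal (K / 2)" "K * d < (\<psi> k (t *\<^sub>R z))\<^sup>2"
        by blast
      \<comment> \<open>The factor 2 of the ray estimate cancels the half in K/2.\<close>
      have "ennreal ((\<psi> k (t *\<^sub>R z))\<^sup>2) \<le> ennreal (2 * d) * ray_energy (grad (\<psi> k)) z"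
        unfolding d_def by (rule test_fun_ray_le[OF \<psi> z(1) \<open>t > 0\<close> t])
      also have "\<dots> \<le> ennreal (2 * d) * ennreal (K / 2)"
        using k(1) by (intro mult_left_mono) auto
      also have "\<dots> = ennreal (K * d)"
        using \<open>d > 0\<close> \<open>K > 0\<close> by (simp add: ennreal_mult'[symmetric] mult.commute)
      finally show False
        using k(2) \<open>d > 0\<close> \<open>K > 0\<close> by (subst (asm) ennreal_le_iff) auto
    qed
  qed
  \<comment> \<open>Substituting r = t |z| removes the chosen ray: the bound becomes a statement
    about almost every radius, which spreads to the annulus.\<close>
  from AE_scaleR[OF _ this, of "1 / norm z"]
  have "AE r in lborel. 1 < r \<and> r < 3 \<longrightarrow> (f r)\<^sup>2 \<le> K * (1 - \<bar>r - 2\<bar>)"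
    using nz by simp
  from AE_annulus_norm[OF this, where 'n='n] f show ?thesis
    by eventually_elim (auto simp: annulus_def)
qed

section \<open>From the pointwise bound to the Rayleigh quotient\<close>

lemma H10_grad_AE_zero_outside:
  fixes u :: "real^'n \<Rightarrow> real"
  assumes H: "H10_grad U u G"
  shows "AE x in lborel. x \<notin> U \<longrightarrow> u x = 0"
proof -
  obtain \<psi> where \<psi>: "\<And>k. test_fun U (\<psi> k)"
    and lim: "AE x in lborel. (\<lambda>k. \<psi> k x) \<longlonglongrightarrow> u x"
    by (rule H10_grad_AE_approx[OF H]) blast
  have "\<psi> k x = 0" if "x \<notin> U" for k x
    using \<psi>[of k] that closure_subset[of "{x. \<psi> k x \<noteq> 0}"] by (auto simp: test_fun_def)
  with lim show ?thesis
    by (auto elim!: eventually_mono simp: LIMSEQ_const_iff)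
qed

lemma Psi_measurable [measurable]: "Psi \<alpha> \<in> borel_measurable borel"
  unfolding Psi_def[abs_def] by measurable

text \<open>The pointwise bound raised to the power p/2 leaves the radial weight integral with
  exponent q = p/2. Integrability is stated separately because the default value 0 of the integral
  would satisfy the upper bound trivially.\<close>

lemma radial_weighted_integral_le:
  fixes u :: "real^'n \<Rightarrow> real"
  assumes H: "H10_grad annulus u G" and rad: "radial u" and "\<alpha> > 0" "p > 0" "K \<ge> 0"
    and K: "24 * 2 ^ CARD('n) / measure lborel (shell :: (real^'n) set)
      * (LINT x:annulus|lborel. (norm (G x))\<^sup>2) < K"
  shows "set_integrable lborel annulus (\<lambda>x. Psi \<alpha> x * \<bar>u x\<bar> powr p)" (is ?int)
    and "(LINT x:annulus|lborel. Psi \<alpha> x * \<bar>u x\<bar> powr p) \<le> K powr (p / 2)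
      * (2 ^ Suc CARD('n) * measure lborel (ball (0::real^'n) 3) * (2 * Gamma (p / 2 + 1) * \<alpha> powr (- (p / 2 + 1))))"
      (is "_ \<le> K powr _ * ?B")
proof -
  have [measurable]: "u \<in> borel_measurable borel"
    using H by (simp add: H10_grad_def)
  let ?J = "\<lambda>x. indicator annulus x *\<^sub>R (Psi \<alpha> x * \<bar>u x\<bar> powr p)"
  let ?w = "\<lambda>r. \<bar>r - 2\<bar> powr \<alpha> * (1 - \<bar>r - 2\<bar>) powr (p / 2)"
  have Gamma: "Gamma (p / 2 + 1) > 0"
    using \<open>p > 0\<close> by (intro Gamma_real_pos) auto
  have B: "?B \<ge> 0"
    using Gamma by simp
  have "AE x in lborel. ennreal (?J x) \<le> ennreal (K powr (p / 2)) * (indicator annulus x * ennreal (?w (norm x)))"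
    using radial_pointwise_bound[OF H rad K]
  proof eventually_elim
    case (elim x)
    show ?case
    proof (cases "x \<in> annulus")
      case True
      define d where "d = 1 - \<bar>norm x - 2\<bar>"
      have "d \<ge> 0" using True by (auto simp: d_def annulus_def)
      have "\<bar>u x\<bar> powr p = (\<bar>u x\<bar> powr 2) powr (p / 2)"
        unfolding powr_powr by simp
      also have "\<bar>u x\<bar> powr 2 = (u x)\<^sup>2"
        by simp
      also have "(u x)\<^sup>2 powr (p / 2) \<le> (K * d) powr (p / 2)"
        using elim True \<open>p > 0\<close> by (intro powr_mono2) (auto simp: d_def)
      also have "\<dots> = K powr (p / 2) * d powr (p / 2)"
        using \<open>d \<ge> 0\<close> \<open>K \<ge> 0\<close> by (simp add: powr_mult)
      finally have "Psi \<alpha> x * \<bar>u x\<bar> powr p \<le> Psi \<alpha> x * (K powr (p / 2) * d powr (p / 2))"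
        by (intro mult_left_mono) (auto simp: Psi_def)
      then show ?thesis
        using True by (auto simp: Psi_def d_def ennreal_mult'[symmetric] mult_ac intro!: ennreal_leI)
    qed auto
  qed
  then have "(\<integral>\<^sup>+x. ennreal (?J x) \<partial>lborel)
      \<le> (\<integral>\<^sup>+x. ennreal (K powr (p / 2)) * (indicator annulus (x::real^'n) * ennreal (?w (norm x))) \<partial>lborel)"
    by (rule nn_integral_mono_AE)
  also have "\<dots> = ennreal (K powr (p / 2)) * (\<integral>\<^sup>+x. indicator annulus x * ennreal (?w (norm (x::real^'n))) \<partial>lborel)"
    by (rule nn_integral_cmult) measurable
  also have "\<dots> \<le> ennreal (K powr (p / 2)) * ennreal ?B"
  proof (rule mult_left_mono)
    have "(\<integral>\<^sup>+x. indicator annulus x * ennreal (?w (norm (x::real^'n))) \<partial>lborel)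
        \<le> ennreal (2 ^ Suc CARD('n) * measure lborel (ball (0::real^'n) 3)) * (\<integral>\<^sup>+r. indicator {1<..<3} r * ennreal (?w r) \<partial>lborel)"
      by (rule nn_integral_annulus_radial_le) measurable
    also have "\<dots> \<le> ennreal (2 ^ Suc CARD('n) * measure lborel (ball (0::real^'n) 3)) * ennreal (2 * Gamma (p / 2 + 1) * \<alpha> powr (- (p / 2 + 1)))"
      using \<open>\<alpha> > 0\<close> \<open>p > 0\<close> by (intro mult_left_mono nn_integral_weight_le) auto
    also have "\<dots> = ennreal ?B"
      by (rule ennreal_mult'[symmetric]) simp
    finally show "(\<integral>\<^sup>+x. indicator annulus x * ennreal (?w (norm (x::real^'n))) \<partial>lborel) \<le> ennreal ?B" .
  qed simp
  also have "\<dots> = ennreal (K powr (p / 2) * ?B)"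
    by (rule ennreal_mult'[symmetric]) simp
  finally have le: "(\<integral>\<^sup>+x. ennreal (?J x) \<partial>lborel) \<le> ennreal (K powr (p / 2) * ?B)" .
  have int: "integrable lborel ?J"
  proof (rule integrableI_nonneg)
    show "(\<integral>\<^sup>+x. ennreal (?J x) \<partial>lborel) < \<infinity>"
      using le ennreal_less_top order_le_less_trans unfolding infinity_ennreal_def by blast
  qed (auto simp: Psi_def)
  then show ?int by (simp add: set_integrable_def)
  have "ennreal (\<integral>x. ?J x \<partial>lborel) = (\<integral>\<^sup>+x. ennreal (?J x) \<partial>lborel)"
    using int by (intro nn_integral_eq_integral[symmetric]) (auto simp: Psi_def)
  with le have "ennreal (\<integral>x. ?J x \<partial>lborel) \<le> ennreal (K powr (p / 2) * ?B)"
    by simp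
  then show "(LINT x:annulus|lborel. Psi \<alpha> x * \<bar>u x\<bar> powr p) \<le> K powr (p / 2) * ?B"
    unfolding set_lebesgue_integral_def using B by (subst (asm) ennreal_le_iff) auto
qed

text \<open>The weight vanishes only on the sphere of radius 2, a null set, and \<open>u\<close>
  vanishes a.e. outside the annulus. An integral equal to 0 would thus force u = 0 almost
  everywhere.\<close>

lemma weighted_integral_pos:
  fixes u :: "real^'n \<Rightarrow> real"
  assumes H: "H10_grad annulus u G" and nz: "nonzero_fun u"
    and int: "set_integrable lborel annulus (\<lambda>x. Psi \<alpha> x * \<bar>u x\<bar> powr p)"
  shows "0 < (LINT x:annulus|lborel. Psi \<alpha> x * \<bar>u x\<bar> powr p)"
proof (rule ccontr)
  let ?J = "\<lambda>x. indicator annulus x *\<^sub>R (Psi \<alpha> x * \<bar>u x\<bar> powr p)"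
  assume "\<not> ?thesis"
  moreover have "(\<integral>x. ?J x \<partial>lborel) \<ge> 0"
    by (intro integral_nonneg_AE) (auto simp: Psi_def)
  ultimately have "(\<integral>x. ?J x \<partial>lborel) = 0"
    by (simp add: set_lebesgue_integral_def)
  then have "AE x in lborel. ?J x = 0"
    using int by (subst (asm) integral_nonneg_eq_0_iff_AE) (auto simp: set_integrable_def Psi_def)
  moreover have "AE x in lborel. (x::real^'n) \<in> annulus \<longrightarrow> norm x \<noteq> 2"
    by (rule AE_annulus_norm[OF AE_lborel_singleton])
  ultimately have "AE x in lborel. u x = 0"
    using H10_grad_AE_zero_outside[OF H]
    by eventually_elim (auto simp: Psi_def indicator_def split: if_splits)
  with nz show False by (simp add: nonzero_fun_def)
qed

text \<open>Raising the bound on the weighted integral to the power 2/p makes it linear in the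
  energy, which then cancels in the quotient. The exponent of \<alpha> is (p/2 + 1)(2/p) = 1 +
  2/p.\<close>

lemma radial_Rayleigh_ge:
  assumes "p > 0"
  obtains c where "c > 0" and "\<And>\<alpha> (u :: real^'n \<Rightarrow> real) G. \<alpha> > 0 \<Longrightarrow> H10_grad annulus u G \<Longrightarrow>
    nonzero_fun u \<Longrightarrow> radial u \<Longrightarrow> c * \<alpha> powr (1 + 2 / p) \<le> Rayleigh \<alpha> p u G"
proof -
  define C1 where "C1 = 24 * 2 ^ CARD('n) / measure lborel (shell :: (real^'n) set)"
  define C2 where "C2 = 2 ^ Suc CARD('n) * measure lborel (ball (0::real^'n) 3) * (2 * Gamma (p / 2 + 1))"
  have "C1 > 0"
    using measure_shell_pos[where 'n='n] by (simp add: C1_def)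
  have "C2 > 0"
    using assms content_ball_pos[of 3 "0::real^'n"] unfolding C2_def
    by (intro mult_pos_pos Gamma_real_pos) auto
  show thesis
  proof (rule that)
    show "1 / (C1 * C2 powr (2 / p)) > 0"
      using \<open>C1 > 0\<close> \<open>C2 > 0\<close> by simp
    fix \<alpha> :: real and u :: "real^'n \<Rightarrow> real" and G
    assume "\<alpha> > 0" and H: "H10_grad annulus u G" and nz: "nonzero_fun u" and rad: "radial u"
    define D where "D = (LINT x:annulus|lborel. (norm (G x))\<^sup>2)"
    define I where "I = (LINT x:annulus|lborel. Psi \<alpha> x * \<bar>u x\<bar> powr p)"
    define B where "B = C2 * \<alpha> powr (- (p / 2 + 1))"
    have "B > 0" using \<open>C2 > 0\<close> \<open>\<alpha> > 0\<close> by (simp add: B_def)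
    have "D \<ge> 0"
      unfolding D_def set_lebesgue_integral_def by (intro integral_nonneg_AE) auto
    then have CD: "C1 * D \<ge> 0" using \<open>C1 > 0\<close> by simp
    have K: "set_integrable lborel annulus (\<lambda>x. Psi \<alpha> x * \<bar>u x\<bar> powr p)" "I \<le> K powr (p / 2) * B"
      if "C1 * D < K" for K
      using radial_weighted_integral_le[OF H rad \<open>\<alpha> > 0\<close> \<open>p > 0\<close>, of K] that CD
      unfolding C1_def D_def I_def B_def C2_def by (auto simp: mult_ac)
    have "I > 0"
      unfolding I_def by (rule weighted_integral_pos[OF H nz K(1)[of "C1 * D + 1"]]) simp
    \<comment> \<open>The estimate is available only for K strictly above \<open>C1 * D\<close>;
      letting K decrease to that value gives the sharp form.\<close>
    have "I powr (2 / p) / B powr (2 / p) \<le> C1 * D"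
    proof (rule dense_ge)
      fix K assume "C1 * D < K"
      then have "I powr (2 / p) \<le> (K powr (p / 2) * B) powr (2 / p)"
        using K(2) \<open>I > 0\<close> \<open>p > 0\<close> by (intro powr_mono2) auto
      also have "\<dots> = K * B powr (2 / p)"
        using \<open>C1 * D < K\<close> CD \<open>B > 0\<close> \<open>p > 0\<close> by (simp add: powr_mult powr_powr)
      finally show "I powr (2 / p) / B powr (2 / p) \<le> K"
        using \<open>B > 0\<close> by (simp add: pos_divide_le_eq)
    qed
    then have "1 / (C1 * B powr (2 / p)) \<le> D / I powr (2 / p)"
      using \<open>C1 > 0\<close> \<open>B > 0\<close> \<open>I > 0\<close> by (simp add: field_simps)
    moreover have "1 / (C1 * B powr (2 / p)) = 1 / (C1 * C2 powr (2 / p)) * \<alpha> powr (1 + 2 / p)"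
    proof -
      have "(\<alpha> powr (- (p / 2 + 1))) powr (2 / p) = \<alpha> powr (- (1 + 2 / p))"
        using \<open>p > 0\<close> unfolding powr_powr by (intro arg_cong[of _ _ "(powr) \<alpha>"]) (simp add: field_simps)
      then have "B powr (2 / p) = C2 powr (2 / p) / \<alpha> powr (1 + 2 / p)"
        using \<open>C2 > 0\<close> unfolding B_def powr_mult by (simp only: powr_minus_divide) simp
      then show ?thesis by simp
    qed
    ultimately show "1 / (C1 * C2 powr (2 / p)) * \<alpha> powr (1 + 2 / p) \<le> Rayleigh \<alpha> p u G"
      by (simp add: Rayleigh_def D_def I_def)
  qed
qed

section \<open>Upper bound by a bump near the outer sphere\<close>

lemma exp_profile_bounded:
  obtains M where "M > 0" "\<And>t. t \<le> 1 \<Longrightarrow> \<bar>exp_profile P t\<bar> \<le> M"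
proof -
  have "continuous_on {0..1} (exp_profile P)"
    using exp_profile_DERIV by (meson DERIV_continuous continuous_at_imp_continuous_on)
  then have "bounded (exp_profile P ` {0..1})"
    by (intro compact_imp_bounded compact_continuous_image) auto
  then obtain M where M: "M > 0" "\<And>y. y \<in> exp_profile P ` {0..1} \<Longrightarrow> norm y \<le> M"
    by (auto simp: bounded_pos)
  have "\<bar>exp_profile P t\<bar> \<le> M" if "t \<le> 1" for t
    using M(1) M(2)[of "exp_profile P t"] that
    by (cases "t \<ge> 0") (auto simp: exp_profile_def)
  with M(1) that show thesis by blast
qed

lemma bump_bounds: "0 \<le> bump c s x" "bump c s x \<le> 1"
  by (auto simp: bump_def exp_profile_def)

lemma bump_nonzero_imp: "s > 0 \<Longrightarrow> bump c s x \<noteq> 0 \<Longrightarrow> dist c x < s"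
  unfolding bump_def exp_profile_def
  by (auto simp: dist_norm norm_minus_commute dot_square_norm abs_square_less_1 simp flip: power_divide split: if_splits)

text \<open>Within half the radius the argument of the profile is at least 1 - 1/4, hence the
  constant 4/3.\<close>

lemma bump_ge:
  assumes "s > 0" "x \<in> ball c (s / 2)"
  shows "exp (- (4 / 3)) \<le> bump c s x"
proof -
  define t where "t = 1 - ((x - c) \<bullet> (x - c)) / s\<^sup>2"
  have "norm (x - c) / s \<le> 1 / 2"
    using assms by (simp add: dist_norm norm_minus_commute field_simps)
  then have "(norm (x - c) / s)\<^sup>2 \<le> (1 / 2)\<^sup>2"
    using assms by (intro power_mono) auto
  then have t: "t \<ge> 3 / 4"
    by (simp add: t_def dot_square_norm power_divide)
  then have "1 / t \<le> 1 / (3 / 4)"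
    by (intro divide_left_mono) auto
  with t show ?thesis
    by (simp add: bump_def exp_profile_def t_def[symmetric])
qed

lemma grad_bump:
  "grad (bump c s) x = (exp_profile ([:0, 0, 1:] * (1 - pderiv 1)) (1 - ((x - c) \<bullet> (x - c)) / s\<^sup>2) * (- 2 / s\<^sup>2)) *\<^sub>R (x - c)"
proof (rule grad_eqI)
  have "(bump c s has_derivative (\<lambda>v. exp_profile ([:0, 0, 1:] * (1 - pderiv 1)) (1 - ((x - c) \<bullet> (x - c)) / s\<^sup>2)
      * (- 2 * ((x - c) \<bullet> v) / s\<^sup>2))) (at x)"
    unfolding bump_def[abs_def]
    by (rule has_derivative_compose_real[OF exp_profile_DERIV has_derivative_quadratic])
  then show "(bump c s has_derivative (\<lambda>v. ((exp_profile ([:0, 0, 1:] * (1 - pderiv 1)) (1 - ((x - c) \<bullet> (x - c)) / s\<^sup>2)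
      * (- 2 / s\<^sup>2)) *\<^sub>R (x - c)) \<bullet> v)) (at x)"
    by (simp only: inner_scaleR_left) (simp add: mult_ac)
qed

text \<open>Scaling makes the gradient of order 1/s. It matters that \<open>M\<close> bounds the
  derivative of the profile alone and so serves every centre and radius.\<close>

lemma norm_grad_bump_le:
  obtains M where "M > 0" "\<And>c s x. s > 0 \<Longrightarrow>
    (norm (grad (bump c s) (x::real^'n)))\<^sup>2 \<le> (2 * M / s)\<^sup>2 * indicator (ball c s) x"
proof -
  obtain M where M: "M > 0" "\<And>t. t \<le> 1 \<Longrightarrow> \<bar>exp_profile ([:0, 0, 1:] * (1 - pderiv 1)) t\<bar> \<le> M"
    by (rule exp_profile_bounded) blast
  have "(norm (grad (bump c s) x))\<^sup>2 \<le> (2 * M / s)\<^sup>2 * indicator (ball c s) x" if "s > 0"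
    for c :: "real^'n" and s x
  proof (cases "x \<in> ball c s")
    case True
    define e where "e = exp_profile ([:0, 0, 1:] * (1 - pderiv 1)) (1 - ((x - c) \<bullet> (x - c)) / s\<^sup>2)"
    have e: "\<bar>e\<bar> \<le> M" unfolding e_def by (rule M(2)) simp
    have x: "norm (x - c) \<le> s" using True by (simp add: dist_norm norm_minus_commute)
    have "norm (grad (bump c s) x) = \<bar>e\<bar> * (2 / s\<^sup>2) * norm (x - c)"
      unfolding grad_bump e_def[symmetric] by (simp add: abs_mult)
    also have "\<dots> \<le> M * (2 / s\<^sup>2) * s"
      using e x M(1) \<open>s > 0\<close> by (intro mult_mono) auto
    also have "\<dots> = 2 * M / s"
      using \<open>s > 0\<close> by (simp add: power2_eq_square)
    finally show ?thesis
      using True by (auto intro!: power_mono)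
  next
    case False
    then have "s \<le> norm (x - c)" by (simp add: dist_norm norm_minus_commute)
    then have "s\<^sup>2 \<le> (x - c) \<bullet> (x - c)"
      using \<open>s > 0\<close> by (simp add: dot_square_norm power_mono)
    then have "1 - ((x - c) \<bullet> (x - c)) / s\<^sup>2 \<le> 0"
      using \<open>s > 0\<close> by (simp add: pos_le_divide_eq)
    then show ?thesis
      using False unfolding grad_bump by (simp add: exp_profile_def)
  qed
  with M(1) that show thesis by blast
qed

lemma test_fun_bump:
  fixes c :: "real^'n"
  assumes "s > 0" "cball c s \<subseteq> U"
  shows "test_fun U (bump c s)"
proof -
  have "{x. bump c s x \<noteq> 0} \<subseteq> cball c s"
    using bump_nonzero_imp[OF \<open>s > 0\<close>, of c] by (force simp: less_imp_le)
  then have "closure {x. bump c s x \<noteq> 0} \<subseteq> cball c s"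
    by (rule closure_minimal) simp
  moreover from this have "compact (closure {x. bump c s x \<noteq> 0})"
    by (meson bounded_cball bounded_subset closed_closure compact_eq_bounded_closed)
  ultimately show ?thesis
    using assms smooth_bump by (auto simp: test_fun_def)
qed

text \<open>Only the inner half ball is kept, where the bump is bounded below. Comparing integrals
  requires integrability of the full integrand, which holds because weight and bump are at most 1 on
  a set of finite measure.\<close>

lemma set_integral_powr_bump_ge:
  fixes c :: "real^'n"
  assumes "s > 0" and sub: "cball c s \<subseteq> annulus" and "\<alpha> \<ge> 0" "p > 0"
    and \<kappa>: "\<kappa> \<ge> 0" "\<And>x. x \<in> ball c (s / 2) \<Longrightarrow> \<kappa> \<le> Psi \<alpha> x"
  shows "\<kappa> * exp (- (4 / 3)) powr p * measure lborel (ball c (s / 2))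
    \<le> (LINT x:annulus|lborel. Psi \<alpha> x * \<bar>bump c s x\<bar> powr p)"
proof -
  have [measurable]: "bump c s \<in> borel_measurable borel"
    by (rule test_fun_measurable(1)[OF test_fun_bump[OF \<open>s > 0\<close> sub]])
  let ?J = "\<lambda>x. indicator annulus x *\<^sub>R (Psi \<alpha> x * \<bar>bump c s x\<bar> powr p)"
  let ?h = "\<lambda>x. (\<kappa> * exp (- (4 / 3)) powr p) * indicator (ball c (s / 2)) x"
  have fin: "emeasure lborel (annulus :: (real^'n) set) < \<infinity>"
    by (intro emeasure_bounded_finite bounded_subset[OF bounded_ball[of 0 3]]) (auto simp: annulus_def)
  have "integrable lborel ?J"
  proof (rule Bochner_Integration.integrable_bound)
    show "integrable lborel (indicator annulus :: real^'n \<Rightarrow> real)"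
      using fin by simp
    have "norm (?J x) \<le> norm (indicator annulus x :: real)" for x
    proof (cases "x \<in> annulus")
      case True
      have "Psi \<alpha> x \<le> 1"
        unfolding Psi_def using True \<open>\<alpha> \<ge> 0\<close> powr_mono2[of \<alpha> "\<bar>norm x - 2\<bar>" 1] by (auto simp: annulus_def)
      moreover have "\<bar>bump c s x\<bar> powr p \<le> 1"
        using bump_bounds[of c s x] \<open>p > 0\<close> powr_mono2[of p "\<bar>bump c s x\<bar>" 1] by auto
      ultimately have "Psi \<alpha> x * \<bar>bump c s x\<bar> powr p \<le> 1 * 1"
        by (intro mult_mono) auto
      with True show ?thesis by (simp add: Psi_def)
    qed simp
    then show "AE x in lborel. norm (?J x) \<le> norm (indicator annulus x :: real)"
      by simp
  qed measurable
  moreover have "integrable lborel ?h"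
    using emeasure_bounded_finite[OF bounded_ball, of c "s / 2"] by simp
  moreover have "?h x \<le> ?J x" for x
  proof (cases "x \<in> ball c (s / 2)")
    case True
    have "ball c (s / 2) \<subseteq> cball c s"
      using \<open>s > 0\<close> by (auto simp: less_imp_le)
    with True sub have "x \<in> annulus" by auto
    moreover have "\<kappa> * exp (- (4 / 3)) powr p \<le> Psi \<alpha> x * \<bar>bump c s x\<bar> powr p"
      using \<kappa> True bump_ge[OF \<open>s > 0\<close> True] bump_bounds(1)[of c s x] \<open>p > 0\<close>
      by (intro mult_mono powr_mono2) (auto simp: Psi_def)
    ultimately show ?thesis using True by simp
  qed (auto simp: Psi_def)
  ultimately have "(\<integral>x. ?h x \<partial>lborel) \<le> (\<integral>x. ?J x \<partial>lborel)"
    by (intro integral_mono) auto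
  then show ?thesis
    by (simp add: set_lebesgue_integral_def)
qed

text \<open>For 0 \<le> x \<le> 1/2 one has ln(1 - x) \<ge> -x - 2 x^2 \<ge> -2 x. Taking x =
  3/\<alpha>, the largest distance from the outer sphere reached by the bump, explains both \<alpha>
  \<ge> 6 and exp(-6).\<close>

lemma Psi_ge_near_boundary:
  assumes "\<alpha> \<ge> 6" "3 - 3 / \<alpha> \<le> norm x"
  shows "exp (- 6) \<le> Psi \<alpha> x"
proof -
  have a: "3 / \<alpha> \<le> 1 / 2" "0 \<le> 3 / \<alpha>" using assms by (auto simp: field_simps)
  have "2 * (3 / \<alpha>)\<^sup>2 \<le> 3 / \<alpha>"
    using a mult_right_mono[of "3 / \<alpha>" "1 / 2" "3 / \<alpha>"] by (simp add: power2_eq_square)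
  then have "- 2 * (3 / \<alpha>) \<le> ln (1 - 3 / \<alpha>)"
    using ln_one_minus_pos_lower_bound[of "3 / \<alpha>"] a by linarith
  then have "\<alpha> * (- 2 * (3 / \<alpha>)) \<le> \<alpha> * ln (1 - 3 / \<alpha>)"
    using assms by (intro mult_left_mono) auto
  then have "exp (- 6) \<le> (1 - 3 / \<alpha>) powr \<alpha>"
    using assms a by (simp add: powr_def)
  also have "\<dots> \<le> Psi \<alpha> x"
    unfolding Psi_def using assms a by (intro powr_mono2) auto
  finally show ?thesis .
qed

lemma inverse_power_eq_powr: "\<alpha> > 0 \<Longrightarrow> (1 / \<alpha>) ^ n = \<alpha> powr (- real n)" for \<alpha> :: real
  by (simp add: powr_minus_divide powr_realpow power_divide)

text \<open>With s = 1/\<alpha> the energy is of order s^(N-2) and the weighted integral at least of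
  order s^N; the latter enters with the power 2/p.\<close>

lemma bump_Rayleigh_le:
  assumes "p > 0"
  obtains C where "C > 0" and "\<And>\<alpha>. \<alpha> \<ge> 6 \<Longrightarrow> \<exists>v :: real^'n \<Rightarrow> real. test_fun annulus v \<and> nonzero_fun v \<and>
    Rayleigh \<alpha> p v (grad v) \<le> C * \<alpha> powr (2 - real CARD('n) + 2 * real CARD('n) / p)"
proof -
  let ?N = "CARD('n)"
  obtain M where M: "M > 0" "\<And>c s x. s > 0 \<Longrightarrow>
      (norm (grad (bump c s) (x::real^'n)))\<^sup>2 \<le> (2 * M / s)\<^sup>2 * indicator (ball c s) x"
    by (rule norm_grad_bump_le) blast
  define \<omega> where "\<omega> = unit_ball_vol (real ?N)"
  have "\<omega> > 0" by (simp add: \<omega>_def)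
  have vol: "measure lborel (ball c r) = \<omega> * r ^ ?N" if "r \<ge> 0" for c :: "real^'n" and r
    using content_ball[OF that, of c] by (simp add: \<omega>_def)
  \<comment> \<open>The factors are the lower bound of the weight, the lower bound of the bump
    raised to p, and the volume of the half ball without its power of s.\<close>
  define \<kappa> where "\<kappa> = exp (- 6) * exp (- (4 / 3)) powr p * \<omega> / 2 ^ ?N"
  have "\<kappa> > 0" using \<open>\<omega> > 0\<close> by (simp add: \<kappa>_def)
  show thesis
  proof (rule that)
    show "4 * M\<^sup>2 * \<omega> / \<kappa> powr (2 / p) > 0"
      using \<open>M > 0\<close> \<open>\<omega> > 0\<close> \<open>\<kappa> > 0\<close> by simp
    fix \<alpha> :: real assume "\<alpha> \<ge> 6"
    define s where "s = 1 / \<alpha>"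
    have s: "s > 0" "s \<le> 1 / 6" using \<open>\<alpha> \<ge> 6\<close> by (auto simp: s_def field_simps)
    \<comment> \<open>At depth 2 s the closed ball of radius s stays at distance at least s from the
      outer sphere, as compact support requires, and at most 3 s, as the weight bound
      requires.\<close>
    obtain c :: "real^'n" where c: "norm c = 3 - 2 * s"
      using vector_choose_size[of "3 - 2 * s"] s by auto
    have near: "3 - 3 * s \<le> norm x \<and> norm x \<le> 3 - s" if "x \<in> cball c s" for x
    proof -
      have "norm (c - x) \<le> s" using that by (simp add: dist_norm)
      then show ?thesis
        using norm_triangle_ineq3[of c x] c by auto
    qed
    have sub: "cball c s \<subseteq> annulus"
      using near s by (force simp: annulus_def)
    define v where "v = bump c s"
    have t: "test_fun annulus v"
      unfolding v_def by (rule test_fun_bump[OF s(1) sub])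
    define I where "I = (LINT x:annulus|lborel. Psi \<alpha> x * \<bar>v x\<bar> powr p)"
    have "exp (- 6) * exp (- (4 / 3)) powr p * measure lborel (ball c (s / 2)) \<le> I"
      unfolding I_def v_def
    proof (rule set_integral_powr_bump_ge[OF s(1) sub])
      fix x assume "x \<in> ball c (s / 2)"
      then have "x \<in> cball c s" using s by simp
      from near[OF this] show "exp (- 6) \<le> Psi \<alpha> x"
        by (intro Psi_ge_near_boundary[OF \<open>\<alpha> \<ge> 6\<close>]) (simp add: s_def)
    qed (use \<open>\<alpha> \<ge> 6\<close> \<open>p > 0\<close> in auto)
    also have "exp (- 6) * exp (- (4 / 3)) powr p * measure lborel (ball c (s / 2)) = \<kappa> * \<alpha> powr (- real ?N)"
    proof -
      have "measure lborel (ball c (s / 2)) = \<omega> * (s ^ ?N / 2 ^ ?N)"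
        using s by (simp add: vol power_divide)
      also have "s ^ ?N = \<alpha> powr (- real ?N)"
        using \<open>\<alpha> \<ge> 6\<close> inverse_power_eq_powr[of \<alpha> ?N] by (simp add: s_def)
      finally show ?thesis by (simp add: \<kappa>_def)
    qed
    finally have I: "\<kappa> * \<alpha> powr (- real ?N) \<le> I" .
    have pos: "\<kappa> * \<alpha> powr (- real ?N) > 0"
      using \<open>\<kappa> > 0\<close> \<open>\<alpha> \<ge> 6\<close> by simp
    have nz: "nonzero_fun v"
      unfolding nonzero_fun_def
    proof
      assume "AE x in lborel. v x = 0"
      then have "I = 0"
        unfolding I_def set_lebesgue_integral_def
        by (intro integral_eq_zero_AE) (auto elim!: eventually_mono)
      with I pos show False by simp
    qed
    have "(LINT x:annulus|lborel. (norm (grad v x))\<^sup>2) \<le> (\<integral>x. (2 * M / s)\<^sup>2 * indicator (ball c s) x \<partial>lborel)"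
      unfolding set_lebesgue_integral_def
    proof (rule integral_mono)
      show "integrable lborel (\<lambda>x. indicator annulus x *\<^sub>R (norm (grad v x))\<^sup>2)"
        by (rule integrable_mult_indicator[OF _ test_fun_integrable(2)[OF t]]) simp
      show "integrable lborel (\<lambda>x. (2 * M / s)\<^sup>2 * indicator (ball c s) x)"
        using emeasure_bounded_finite[OF bounded_ball, of c s] by simp
      show "indicator annulus x *\<^sub>R (norm (grad v x))\<^sup>2 \<le> (2 * M / s)\<^sup>2 * indicator (ball c s) x" for x
        using M(2)[OF s(1), of c x] by (cases "x \<in> annulus") (auto simp: v_def)
    qed
    also have "\<dots> = (2 * M / s)\<^sup>2 * (\<omega> * s ^ ?N)"
      using s by (simp add: vol)
    also have "\<dots> = 4 * M\<^sup>2 * \<omega> * \<alpha> powr (2 - real ?N)"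
    proof -
      have "\<alpha> powr (2 - real ?N) = \<alpha> powr 2 * \<alpha> powr (- real ?N)"
        by (simp flip: powr_add)
      also have "\<dots> = \<alpha>\<^sup>2 * s ^ ?N"
        using \<open>\<alpha> \<ge> 6\<close> inverse_power_eq_powr[of \<alpha> ?N] by (simp add: s_def powr_numeral)
      finally show ?thesis
        by (simp add: s_def power_mult_distrib)
    qed
    finally have D: "(LINT x:annulus|lborel. (norm (grad v x))\<^sup>2) \<le> 4 * M\<^sup>2 * \<omega> * \<alpha> powr (2 - real ?N)" .
    have "Rayleigh \<alpha> p v (grad v) = (LINT x:annulus|lborel. (norm (grad v x))\<^sup>2) / I powr (2 / p)"
      by (simp add: Rayleigh_def I_def)
    also have "\<dots> \<le> (4 * M\<^sup>2 * \<omega> * \<alpha> powr (2 - real ?N)) / (\<kappa> * \<alpha> powr (- real ?N)) powr (2 / p)"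
      using \<open>\<omega> > 0\<close> \<open>\<kappa> > 0\<close> \<open>\<alpha> \<ge> 6\<close> \<open>p > 0\<close> I pos
      by (intro frac_le D powr_mono2) auto
    also have "(\<kappa> * \<alpha> powr (- real ?N)) powr (2 / p) = \<kappa> powr (2 / p) * \<alpha> powr (- (2 * real ?N / p))"
      using \<open>\<kappa> > 0\<close> by (simp add: powr_mult powr_powr mult.commute)
    also have "(4 * M\<^sup>2 * \<omega> * \<alpha> powr (2 - real ?N)) / (\<kappa> powr (2 / p) * \<alpha> powr (- (2 * real ?N / p)))
        = 4 * M\<^sup>2 * \<omega> / \<kappa> powr (2 / p) * \<alpha> powr (2 - real ?N + 2 * real ?N / p)"
      by (simp add: powr_add powr_minus_divide)
    finally show "\<exists>v :: real^'n \<Rightarrow> real. test_fun annulus v \<and> nonzero_fun v \<and>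
        Rayleigh \<alpha> p v (grad v) \<le> 4 * M\<^sup>2 * \<omega> / \<kappa> powr (2 / p) * \<alpha> powr (2 - real ?N + 2 * real ?N / p)"
      using t nz by blast
  qed
qed

section \<open>Comparison of the two growth rates\<close>

theorem theorem2p4:
  fixes p :: real
  assumes "CARD('n) \<ge> 3"
    and "2 < p"
    and "p < 2 * real CARD('n) / (real CARD('n) - 2)"
  shows "\<exists>\<alpha>0. \<forall>\<alpha> \<ge> \<alpha>0. \<forall>u :: real^'n \<Rightarrow> real. ground_state \<alpha> p u \<longrightarrow> \<not> radial u"
proof -
  have "p > 0" using assms by simp
  obtain c where c: "c > 0" "\<And>\<alpha> (u :: real^'n \<Rightarrow> real) G. \<alpha> > 0 \<Longrightarrow> H10_grad annulus u G \<Longrightarrow>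
      nonzero_fun u \<Longrightarrow> radial u \<Longrightarrow> c * \<alpha> powr (1 + 2 / p) \<le> Rayleigh \<alpha> p u G"
    by (rule radial_Rayleigh_ge[OF \<open>p > 0\<close>]) blast
  define E where "E = 2 - real CARD('n) + 2 * real CARD('n) / p"
  obtain C where C: "C > 0" "\<And>\<alpha>. \<alpha> \<ge> 6 \<Longrightarrow> \<exists>v :: real^'n \<Rightarrow> real. test_fun annulus v \<and> nonzero_fun v \<and>
      Rayleigh \<alpha> p v (grad v) \<le> C * \<alpha> powr E"
    unfolding E_def by (rule bump_Rayleigh_le[OF \<open>p > 0\<close>]) blast
  define \<delta> where "\<delta> = (real CARD('n) - 1) * (1 - 2 / p)"
  have "\<delta> > 0"
    unfolding \<delta>_def using assms by (intro mult_pos_pos) auto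
  have \<delta>: "1 + 2 / p = \<delta> + E"
    unfolding \<delta>_def E_def using \<open>p > 0\<close> by (simp add: field_simps)
  \<comment> \<open>The bump estimate needs \<alpha> \<ge> 6. The second term gives
    \<open>c * \<alpha> powr \<delta>\<close> \<ge> C + c, against the bound C that minimality would
    imply.\<close>
  define \<alpha>0 where "\<alpha>0 = max 6 ((C / c + 1) powr (1 / \<delta>))"
  have "\<not> radial u" if \<alpha>: "\<alpha> \<ge> \<alpha>0" and gs: "ground_state \<alpha> p u" for \<alpha> and u :: "real^'n \<Rightarrow> real"
  proof
    assume "radial u"
    have "\<alpha> \<ge> 6" "\<alpha> \<ge> (C / c + 1) powr (1 / \<delta>)"
      using \<alpha> by (auto simp: \<alpha>0_def)
    \<comment> \<open>The lower bound holds for every admissible pair, hence for whichever weak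
      gradient the definition of a ground state supplies.\<close>
    obtain G where G: "H10_grad annulus u G" "nonzero_fun u"
      and min: "\<And>(v :: real^'n \<Rightarrow> real) H. H10_grad annulus v H \<Longrightarrow> nonzero_fun v \<Longrightarrow> Rayleigh \<alpha> p u G \<le> Rayleigh \<alpha> p v H"
      using gs unfolding ground_state_def by blast
    obtain v :: "real^'n \<Rightarrow> real" where v: "test_fun annulus v" "nonzero_fun v"
      and R: "Rayleigh \<alpha> p v (grad v) \<le> C * \<alpha> powr E"
      using C(2)[OF \<open>\<alpha> \<ge> 6\<close>] by blast
    have "c * \<alpha> powr (1 + 2 / p) \<le> Rayleigh \<alpha> p u G"
      using \<open>\<alpha> \<ge> 6\<close> by (intro c(2) G \<open>radial u\<close>) simp
    also have "\<dots> \<le> Rayleigh \<alpha> p v (grad v)"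
      by (rule min[OF test_fun_H10_grad[OF v(1)] v(2)])
    also note R
    finally have "(c * \<alpha> powr \<delta>) * \<alpha> powr E \<le> C * \<alpha> powr E"
      by (simp add: \<delta> powr_add mult.assoc)
    then have "c * \<alpha> powr \<delta> \<le> C"
      using \<open>\<alpha> \<ge> 6\<close> by simp
    moreover have "((C / c + 1) powr (1 / \<delta>)) powr \<delta> \<le> \<alpha> powr \<delta>"
      using \<open>\<alpha> \<ge> _ powr _\<close> \<open>\<delta> > 0\<close> by (intro powr_mono2) auto
    then have "C / c + 1 \<le> \<alpha> powr \<delta>"
      using \<open>\<delta> > 0\<close> C(1) c(1) by (simp add: powr_powr add_nonneg_nonneg)
    then have "C + c \<le> c * \<alpha> powr \<delta>"
      using c(1) by (simp add: field_simps)
    ultimately show False using c(1) by simp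
  qed
  then show ?thesis by blast
qed

end
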